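(* Let $1<k\le n/2$, $s\ge1$, and let $I_1,\dots,I_s$ be $k$-subsets of $\{1,\dots,n\}$. Then $L(I_1,\dots,I_s)\in\mathrm{CM}(B_{k,n})$; that is, $L(I_1,\dots,I_s)$ is a $B_{k,n}$-module and it is free over the center of $B_{k,n}$.
   Context: The algebra $B=B_{k,n}$: take the quiver with vertex set $\mathbb{Z}_n$ and, for each $i\in\mathbb{Z}_n$, arrows $x_i\colon i-1\to i$ and $y_i\colon i\to i-1$. $B$ is the completed path algebra over $\mathbb{C}$ (completion with respect to the ideal generated by arrows) modulo the closure of the ideal generated by the relations $xy=yx$ and $x^k=y^{n-k}$ at every vertex (subscripts determined by the starting vertex). Its center is $Z=\mathbb{C}[[t]]$, $t=\sum_i x_iy_i$. Modules are left modules, i.e. representations of the quiver with relations. $\mathrm{CM}(B)$ is the category of (finitely generated) $B$-modules that are free over $Z$. Construction of $L(I_1,\dots,I_s)$: let $\sigma$ be the $s\times s$ matrix over $\mathbb{C}[[t]]$ given by $\sigma=\sum_{i=1}^{s-1}E_{i,i+1}+tE_{s,1}$, where $E_{i,j}$ are the elementary matrices; it satisfies $\sigma^s=t\,\mathrm{Id}_s$. For $i\in\{1,\dots,n\}$ let $r_i=|\{j: i\in I_j\}|$. Put $V_i=e_iL(I_1,\dots,I_s)=\mathbb{C}[[t]]^s$ for each vertex $i\in\mathbb{Z}_n$, let $x_i\colon V_{i-1}\to V_i$ be multiplication by $\sigma^{s-r_i}$ and $y_i\colon V_i\to V_{i-1}$ be multiplication by $\sigma^{r_i}$. *)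

theory Defs
  imports
    "HOL-Computational_Algebra.Formal_Power_Series"
    "HOL-Algebra.QuotRing"
    "HOL-Algebra.Module"
    "Jordan_Normal_Form.Matrix"
begin

section \<open>Left modules over a not necessarily commutative ring\<close>

locale left_module = R?: ring R + M?: abelian_group M
  for R :: "('a, 'c) ring_scheme" (structure) and M :: "('a, 'b, 'd) module_scheme" (structure) +
  assumes smult_closed:
      "\<lbrakk>a \<in> carrier R; x \<in> carrier M\<rbrakk> \<Longrightarrow> a \<odot>\<^bsub>M\<^esub> x \<in> carrier M"
    and smult_l_distr:
      "\<lbrakk>a \<in> carrier R; b \<in> carrier R; x \<in> carrier M\<rbrakk> \<Longrightarrow>
        (a \<oplus>\<^bsub>R\<^esub> b) \<odot>\<^bsub>M\<^esub> x = a \<odot>\<^bsub>M\<^esub> x \<oplus>\<^bsub>M\<^esub> b \<odot>\<^bsub>M\<^esub> x"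
    and smult_r_distr:
      "\<lbrakk>a \<in> carrier R; x \<in> carrier M; y \<in> carrier M\<rbrakk> \<Longrightarrow>
        a \<odot>\<^bsub>M\<^esub> (x \<oplus>\<^bsub>M\<^esub> y) = a \<odot>\<^bsub>M\<^esub> x \<oplus>\<^bsub>M\<^esub> a \<odot>\<^bsub>M\<^esub> y"
    and smult_assoc:
      "\<lbrakk>a \<in> carrier R; b \<in> carrier R; x \<in> carrier M\<rbrakk> \<Longrightarrow>
        (a \<otimes>\<^bsub>R\<^esub> b) \<odot>\<^bsub>M\<^esub> x = a \<odot>\<^bsub>M\<^esub> (b \<odot>\<^bsub>M\<^esub> x)"
    and smult_one:
      "x \<in> carrier M \<Longrightarrow> \<one>\<^bsub>R\<^esub> \<odot>\<^bsub>M\<^esub> x = x"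

definition finitely_generated ::
    "('a, 'c) ring_scheme \<Rightarrow> ('a, 'b, 'd) module_scheme \<Rightarrow> bool" where
  "finitely_generated R M \<longleftrightarrow>
     (\<exists>S. finite S \<and> S \<subseteq> carrier M \<and>
        (\<forall>v\<in>carrier M. \<exists>c \<in> S \<rightarrow> carrier R. v = (\<Oplus>\<^bsub>M\<^esub>x\<in>S. c x \<odot>\<^bsub>M\<^esub> x)))"

definition is_basis ::
    "('a, 'c) ring_scheme \<Rightarrow> ('a, 'b, 'd) module_scheme \<Rightarrow> 'b set \<Rightarrow> bool" where
  "is_basis R M S \<longleftrightarrow> S \<subseteq> carrier M \<and>
     (\<forall>v\<in>carrier M. \<exists>!c. (\<forall>x\<in>S. c x \<in> carrier R) \<and> (\<forall>x. x \<notin> S \<longrightarrow> c x = \<zero>\<^bsub>R\<^esub>) \<and>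
        finite {x. c x \<noteq> \<zero>\<^bsub>R\<^esub>} \<and>
        v = (\<Oplus>\<^bsub>M\<^esub>x\<in>{x. c x \<noteq> \<zero>\<^bsub>R\<^esub>}. c x \<odot>\<^bsub>M\<^esub> x))"

definition free_module ::
    "('a, 'c) ring_scheme \<Rightarrow> ('a, 'b, 'd) module_scheme \<Rightarrow> bool" where
  "free_module R M \<longleftrightarrow> module R M \<and> (\<exists>S. is_basis R M S)"

definition ring_center :: "('a, 'c) ring_scheme \<Rightarrow> ('a, 'c) ring_scheme" where
  "ring_center R =
     R\<lparr>carrier := {z \<in> carrier R. \<forall>a\<in>carrier R. z \<otimes>\<^bsub>R\<^esub> a = a \<otimes>\<^bsub>R\<^esub> z}\<rparr>"


section \<open>The quiver and its completed path algebra\<close>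

text \<open>The vertex set \<open>\<int>/n\<close> is represented by \<open>{1..n}\<close>; \<open>vtx n m\<close> is the representative of the
  class of \<open>m\<close>.\<close>

definition vtx :: "nat \<Rightarrow> int \<Rightarrow> nat" where
  "vtx n m = nat ((m - 1) mod int n) + 1"

datatype arrow = X nat | Y nat

fun arrow_source :: "nat \<Rightarrow> arrow \<Rightarrow> nat" where
  "arrow_source n (X i) = vtx n (int i - 1)"
| "arrow_source n (Y i) = i"

fun arrow_target :: "nat \<Rightarrow> arrow \<Rightarrow> nat" where
  "arrow_target n (X i) = i"
| "arrow_target n (Y i) = vtx n (int i - 1)"

definition arrows :: "nat \<Rightarrow> arrow set" where
  "arrows n = X ` {1..n} \<union> Y ` {1..n}"

text \<open>A path is a pair of its word and its starting vertex. Words are written like compositions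
  of maps, as is appropriate for left modules: in \<open>([a, b], i)\<close> the arrow \<open>b\<close> is traversed first.\<close>

type_synonym path = "arrow list \<times> nat"

fun path_target :: "nat \<Rightarrow> path \<Rightarrow> nat" where
  "path_target n ([], i) = i"
| "path_target n (a # as, i) = arrow_target n a"

fun is_path :: "nat \<Rightarrow> path \<Rightarrow> bool" where
  "is_path n ([], i) \<longleftrightarrow> i \<in> {1..n}"
| "is_path n (a # as, i) \<longleftrightarrow>
     a \<in> arrows n \<and> is_path n (as, i) \<and> arrow_source n a = path_target n (as, i)"

text \<open>There are only finitely many paths of each length, and the \<open>N\<close>-th power of the arrow ideal
  is spanned by the paths of length at least \<open>N\<close>. So the completion with respect to the arrow ideal
  consists of all formal, possibly infinite, linear combinations of paths, with the convolution
  product. A combination is encoded by its coefficient function, which vanishes off the paths.\<close>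

definition completed_path_algebra :: "nat \<Rightarrow> (path \<Rightarrow> complex) ring" where
  "completed_path_algebra n =
    \<lparr>carrier = {f. \<forall>p. \<not> is_path n p \<longrightarrow> f p = 0},
     mult = (\<lambda>f g (as, i). \<Sum>m\<le>length as.
               f (take m as, path_target n (drop m as, i)) * g (drop m as, i)),
     one = (\<lambda>(as, i). if as = [] \<and> i \<in> {1..n} then 1 else 0),
     zero = (\<lambda>p. 0),
     add = (\<lambda>f g p. f p + g p)\<rparr>"

text \<open>Closure in the topology defined by the powers of the arrow ideal.\<close>

definition arrow_adic_closure :: "nat \<Rightarrow> (path \<Rightarrow> complex) set \<Rightarrow> (path \<Rightarrow> complex) set" where
  "arrow_adic_closure n J =
     {f \<in> carrier (completed_path_algebra n).
        \<forall>N. \<exists>g\<in>J. \<forall>p. length (fst p) < N \<longrightarrow> f p = g p}"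


section \<open>The algebra B and its category CM(B)\<close>

definition single :: "path \<Rightarrow> path \<Rightarrow> complex" where
  "single p = (\<lambda>q. if q = p then 1 else 0)"

text \<open>The paths \<open>x\<^sub>i\<^sub>+\<^sub>m \<dots> x\<^sub>i\<^sub>+\<^sub>1\<close> and \<open>y\<^sub>i\<^sub>-\<^sub>m\<^sub>+\<^sub>1 \<dots> y\<^sub>i\<close> starting at the vertex \<open>i\<close>.\<close>

definition x_power :: "nat \<Rightarrow> nat \<Rightarrow> nat \<Rightarrow> path" where
  "x_power n m i = (rev (map (\<lambda>l. X (vtx n (int i + int l + 1))) [0..<m]), i)"

definition y_power :: "nat \<Rightarrow> nat \<Rightarrow> nat \<Rightarrow> path" where
  "y_power n m i = (rev (map (\<lambda>l. Y (vtx n (int i - int l))) [0..<m]), i)"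

definition B_relations :: "nat \<Rightarrow> nat \<Rightarrow> (path \<Rightarrow> complex) set" where
  "B_relations k n =
     (\<Union>i\<in>{1..n}.
       {\<lambda>q. single ([X i, Y i], i) q
            - single ([Y (vtx n (int i + 1)), X (vtx n (int i + 1))], i) q,
        \<lambda>q. single (x_power n k i) q - single (y_power n (n - k) i) q})"

definition B_ideal :: "nat \<Rightarrow> nat \<Rightarrow> (path \<Rightarrow> complex) set" where
  "B_ideal k n = arrow_adic_closure n (genideal (completed_path_algebra n) (B_relations k n))"

definition B_algebra :: "nat \<Rightarrow> nat \<Rightarrow> (path \<Rightarrow> complex) set ring" where
  "B_algebra k n = completed_path_algebra n Quot B_ideal k n"

definition CM :: "('a, 'c) ring_scheme \<Rightarrow> ('a, 'b) module set" where
  "CM R = {M. left_module R M \<and> finitely_generated R M \<and> free_module (ring_center R) M}"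


section \<open>The module \<open>L(I\<^sub>1, \<dots>, I\<^sub>s)\<close>\<close>

text \<open>The matrix \<open>\<sigma>\<close>, with rows and columns numbered from \<open>0\<close>.\<close>

definition sigma_mat :: "nat \<Rightarrow> complex fps mat" where
  "sigma_mat s = mat s s (\<lambda>(a, b).
     (if b = a + 1 then 1 else 0) + (if a = s - 1 \<and> b = 0 then fps_X else 0))"

definition r_num :: "nat \<Rightarrow> (nat \<Rightarrow> nat set) \<Rightarrow> nat \<Rightarrow> nat" where
  "r_num s I i = card {j \<in> {1..s}. i \<in> I j}"

fun L_arrow :: "nat \<Rightarrow> (nat \<Rightarrow> nat set) \<Rightarrow> arrow \<Rightarrow> complex fps mat" where
  "L_arrow s I (X i) = sigma_mat s ^\<^sub>m (s - r_num s I i)"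
| "L_arrow s I (Y i) = sigma_mat s ^\<^sub>m r_num s I i"

definition L_path ::
    "nat \<Rightarrow> (nat \<Rightarrow> nat set) \<Rightarrow> path \<Rightarrow> complex fps vec \<Rightarrow> complex fps vec" where
  "L_path s I p v = foldr (\<lambda>a w. L_arrow s I a *\<^sub>v w) (fst p) v"

text \<open>An element \<open>v\<close> of the direct sum of the spaces \<open>V\<^sub>i\<close> is the family of its components
  \<open>v i\<close>. An element of the completed path algebra is the limit of its truncations to paths of length
  less than \<open>N\<close>, and acts as the limit of the actions of these; the limit is taken componentwise, in
  the \<open>t\<close>-adic topology of \<open>\<complex>[[t]]\<close>, which is the topology given by the library metric on \<open>fps\<close>.\<close>

definition L_act ::
    "nat \<Rightarrow> nat \<Rightarrow> (nat \<Rightarrow> nat set) \<Rightarrow> (path \<Rightarrow> complex) \<Rightarrow>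
     (nat \<Rightarrow> complex fps vec) \<Rightarrow> (nat \<Rightarrow> complex fps vec)" where
  "L_act n s I f v =
     (\<lambda>j\<in>{1..n}. vec s (\<lambda>c. lim (\<lambda>N.
        \<Sum>p\<in>{p. is_path n p \<and> path_target n p = j \<and> length (fst p) < N}.
          fps_const (f p) * (L_path s I p (v (snd p)) $ c))))"

text \<open>Elements of \<open>B\<close> are cosets in the completed path algebra; such a coset acts through any of
  its representatives. The value given to it by \<open>the_elem\<close> is unspecified if the representatives
  do not all act in the same way. The fields \<open>mult\<close> and \<open>one\<close> of the record type \<open>module\<close> are not
  part of a module structure.\<close>

definition L_module ::
    "nat \<Rightarrow> nat \<Rightarrow> (nat \<Rightarrow> nat set) \<Rightarrow>
     ((path \<Rightarrow> complex) set, nat \<Rightarrow> complex fps vec) module" where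
  "L_module n s I =
    \<lparr>carrier = (\<Pi>\<^sub>E i\<in>{1..n}. carrier_vec s),
     mult = undefined,
     one = undefined,
     zero = (\<lambda>i\<in>{1..n}. 0\<^sub>v s),
     add = (\<lambda>v w. \<lambda>i\<in>{1..n}. v i + w i),
     smult = (\<lambda>b v. the_elem ((\<lambda>f. L_act n s I f v) ` b))\<rparr>"

end

theory Submission
  imports Defs "HOL-Algebra.Subrings"
begin

text \<open>
  The matrix \<open>\<sigma>\<close> makes \<open>\<complex>[[t]]\<^sup>s\<close> a free module of rank one over \<open>\<complex>[[u]]\<close>, with \<open>u\<close> acting as
  \<open>\<sigma>\<close> and \<open>t = u\<^sup>s\<close>. A path of weight \<open>d\<close> (the sum of the exponents of its arrows) acts as \<open>u\<^sup>d\<close>,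
  so an element \<open>f\<close> of the completed path algebra acts through its symbol, an \<open>n \<times> n\<close> matrix
  over \<open>\<complex>[[u]]\<close>, and the symbol is multiplicative. The closed ideal defining \<open>B\<close> is exactly the kernel
  of the symbol: two paths with the same endpoints and the same weight are congruent modulo the
  relations, because both can be rewritten to a normal form \<open>x\<^sup>a y\<^sup>b\<close> and \<open>x\<^sup>k\<close> can be traded for
  \<open>y\<^sup>n\<^sup>-\<^sup>k\<close>; and only finitely many paths have a given weight. Hence \<open>L\<close> is a faithful \<open>B\<close>-module.
  An element of \<open>B\<close> that commutes with the vertex idempotents and the arrows \<open>x\<^sub>i\<close> has a scalar
  symbol, and since loops have weights divisible by \<open>s\<close>, the scalar is a power series in \<open>t\<close>. So the
  center is \<open>\<complex>[[t]]\<close>, acting on \<open>L\<close> by scalars, and the unit vectors at the vertices form a basis.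
\<close>

section \<open>The completed path algebra\<close>

lemma path_target_append [simp]:
  "path_target n (us @ ws, i) = path_target n (us, path_target n (ws, i))"
  by (cases us) auto

lemma vtx_range: "0 < n \<Longrightarrow> vtx n m \<in> {1..n}"
proof -
  assume "0 < n"
  then have "nat ((m - 1) mod int n) < n"
    by (simp add: nat_less_iff)
  then show ?thesis by (simp add: vtx_def)
qed

lemma vtx_of_nat: "i \<in> {1..n} \<Longrightarrow> vtx n (int i) = i"
  unfolding vtx_def by (subst mod_pos_pos_trivial) auto

lemma vtx_cong: "m mod int n = m' mod int n \<Longrightarrow> vtx n m = vtx n m'"
  unfolding vtx_def by (metis mod_diff_left_eq)

lemma vtx_mod: "0 < n \<Longrightarrow> int (vtx n m) mod int n = m mod int n"
proof -
  assume "0 < n"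
  then have "int (vtx n m) = (m - 1) mod int n + 1"
    by (simp add: vtx_def)
  then show ?thesis by (simp add: mod_simps)
qed

lemma vtx_eq_iff: "0 < n \<Longrightarrow> vtx n m = vtx n m' \<longleftrightarrow> m mod int n = m' mod int n"
  by (metis vtx_cong vtx_mod)

lemma is_path_target: "is_path n p \<Longrightarrow> path_target n p \<in> {1..n}"
proof (induction p rule: is_path.induct)
  case (2 n a as i)
  then show ?case
    by (cases a) (auto simp: arrows_def intro!: vtx_range[simplified])
qed auto

lemma is_path_source: "is_path n (as, i) \<Longrightarrow> i \<in> {1..n}"
  by (induction as) auto

lemma is_path_append:
  "is_path n (us @ ws, i) \<longleftrightarrow> is_path n (ws, i) \<and> is_path n (us, path_target n (ws, i))"
  by (induction us) (use is_path_target in auto)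

lemma is_path_arrows: "is_path n (as, i) \<Longrightarrow> set as \<subseteq> arrows n"
  by (induction as) auto

lemma finite_paths: "finite {p. is_path n p \<and> length (fst p) < N}"
proof (rule finite_subset)
  show "{p. is_path n p \<and> length (fst p) < N} \<subseteq>
      {as. set as \<subseteq> arrows n \<and> length as \<le> N} \<times> {1..n}"
    using is_path_source is_path_arrows by fastforce
  show "finite ({as. set as \<subseteq> arrows n \<and> length as \<le> N} \<times> {1..n})"
    by (intro finite_cartesian_product finite_lists_length_le) (auto simp: arrows_def)
qed

abbreviation split_left :: "nat \<Rightarrow> path \<Rightarrow> nat \<Rightarrow> path" where
  "split_left n p m \<equiv> (take m (fst p), path_target n (drop m (fst p), snd p))"

abbreviation split_right :: "path \<Rightarrow> nat \<Rightarrow> path" where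
  "split_right p m \<equiv> (drop m (fst p), snd p)"

lemma is_path_split: "is_path n p \<longleftrightarrow> is_path n (split_left n p m) \<and> is_path n (split_right p m)"
  using is_path_append[of n "take m (fst p)" "drop m (fst p)" "snd p"] by (auto)

lemma carrier_cpa: "carrier (completed_path_algebra n) = {f. \<forall>p. \<not> is_path n p \<longrightarrow> f p = 0}"
  and zero_cpa: "\<zero>\<^bsub>completed_path_algebra n\<^esub> = (\<lambda>p. 0)"
  and one_cpa: "\<one>\<^bsub>completed_path_algebra n\<^esub> = (\<lambda>p. if fst p = [] \<and> snd p \<in> {1..n} then 1 else 0)"
  and add_cpa: "f \<oplus>\<^bsub>completed_path_algebra n\<^esub> g = (\<lambda>p. f p + g p)"
  and mult_cpa: "f \<otimes>\<^bsub>completed_path_algebra n\<^esub> g =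
      (\<lambda>p. \<Sum>m\<le>length (fst p). f (split_left n p m) * g (split_right p m))"
  by (auto simp: completed_path_algebra_def)

text \<open>Both bracketings sum over the ways to cut a path into three consecutive pieces. The
  reindexing is the one for associativity of the product of power series, with
  \<open>F u v w\<close> as the contribution of pieces of lengths \<open>u\<close>,
  \<open>v\<close>, \<open>w\<close>.\<close>

lemma cpa_mult_assoc:
  "f \<otimes>\<^bsub>completed_path_algebra n\<^esub> g \<otimes>\<^bsub>completed_path_algebra n\<^esub> h =
   f \<otimes>\<^bsub>completed_path_algebra n\<^esub> (g \<otimes>\<^bsub>completed_path_algebra n\<^esub> h)"
proof (rule ext, clarify)
  fix as i
  define F where "F u v w = f (take u as, path_target n (drop u as, i)) *
      (g (take v (drop u as), path_target n (drop (u + v) as, i)) * h (drop (u + v) as, i))"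
    for u v and w :: nat
  have "(f \<otimes>\<^bsub>completed_path_algebra n\<^esub> g \<otimes>\<^bsub>completed_path_algebra n\<^esub> h) (as, i) =
      (\<Sum>j=0..length as. \<Sum>u=0..j. F u (j - u) (length as - j))"
    unfolding mult_cpa F_def sum_distrib_right atMost_atLeast0
  proof (rule sum.cong, simp, rule sum.cong)
    fix j u assume j: "j \<in> {0..length as}" and u: "u \<in> {0..j}"
    have "drop u (take j as) = take (j - u) (drop u as)"
      by (simp add: drop_take)
    moreover have "drop u as = take (j - u) (drop u as) @ drop j as"
      using u by (metis add.commute append_take_drop_id atLeastAtMost_iff drop_drop le_add_diff_inverse2)
    then have "path_target n (drop u as, i) =
        path_target n (take (j - u) (drop u as), path_target n (drop j as, i))"
      by (metis path_target_append)
    ultimately show "f (split_left n (split_left n (as, i) j) u) *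
          g (split_right (split_left n (as, i) j) u) * h (split_right (as, i) j) =
        f (take u as, path_target n (drop u as, i)) *
        (g (take (j - u) (drop u as), path_target n (drop (u + (j - u)) as, i)) *
         h (drop (u + (j - u)) as, i))"
      using j u by (simp add: min_def mult.assoc)
  qed (auto simp: min_def)
  also have "\<dots> = (\<Sum>j=0..length as. \<Sum>u=0..length as - j. F j u (length as - j - u))"
    by (rule fps_mult_assoc_lemma)
  also have "\<dots> = (f \<otimes>\<^bsub>completed_path_algebra n\<^esub> (g \<otimes>\<^bsub>completed_path_algebra n\<^esub> h)) (as, i)"
    unfolding mult_cpa F_def sum_distrib_left atMost_atLeast0
    by (intro sum.cong) (auto simp: add.commute)
  finally show "(f \<otimes>\<^bsub>completed_path_algebra n\<^esub> g \<otimes>\<^bsub>completed_path_algebra n\<^esub> h) (as, i) =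
      (f \<otimes>\<^bsub>completed_path_algebra n\<^esub> (g \<otimes>\<^bsub>completed_path_algebra n\<^esub> h)) (as, i)" .
qed

lemma cpa_one_mult:
  assumes "f \<in> carrier (completed_path_algebra n)"
  shows "\<one>\<^bsub>completed_path_algebra n\<^esub> \<otimes>\<^bsub>completed_path_algebra n\<^esub> f = f"
proof (rule ext, clarify)
  fix as i
  have "(\<one>\<^bsub>completed_path_algebra n\<^esub> \<otimes>\<^bsub>completed_path_algebra n\<^esub> f) (as, i) =
      (\<Sum>m\<in>{0::nat}. if path_target n (as, i) \<in> {1..n} then f (as, i) else 0)"
    unfolding mult_cpa one_cpa by (rule sum.mono_neutral_cong_right) auto
  also have "\<dots> = f (as, i)"
    using assms is_path_target[of n "(as, i)"] by (auto simp: carrier_cpa)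
  finally show "(\<one>\<^bsub>completed_path_algebra n\<^esub> \<otimes>\<^bsub>completed_path_algebra n\<^esub> f) (as, i) = f (as, i)" .
qed

lemma cpa_mult_one:
  assumes "f \<in> carrier (completed_path_algebra n)"
  shows "f \<otimes>\<^bsub>completed_path_algebra n\<^esub> \<one>\<^bsub>completed_path_algebra n\<^esub> = f"
proof (rule ext, clarify)
  fix as i
  have "(f \<otimes>\<^bsub>completed_path_algebra n\<^esub> \<one>\<^bsub>completed_path_algebra n\<^esub>) (as, i) =
      (\<Sum>m\<in>{length as}. if i \<in> {1..n} then f (as, i) else 0)"
    unfolding mult_cpa one_cpa by (rule sum.mono_neutral_cong_right) auto
  also have "\<dots> = f (as, i)"
    using assms is_path_source[of n as i] by (auto simp: carrier_cpa)
  finally show "(f \<otimes>\<^bsub>completed_path_algebra n\<^esub> \<one>\<^bsub>completed_path_algebra n\<^esub>) (as, i) = f (as, i)" .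
qed

lemma ring_completed_path_algebra: "ring (completed_path_algebra n)"
proof (rule ringI)
  show "abelian_group (completed_path_algebra n)"
  proof (rule abelian_groupI)
    fix f assume f: "f \<in> carrier (completed_path_algebra n)"
    show "\<exists>g\<in>carrier (completed_path_algebra n). g \<oplus>\<^bsub>completed_path_algebra n\<^esub> f = \<zero>\<^bsub>completed_path_algebra n\<^esub>"
      by (rule bexI[of _ "\<lambda>p. - f p"]) (use f in \<open>auto simp: carrier_cpa add_cpa zero_cpa\<close>)
  qed (auto simp: carrier_cpa add_cpa zero_cpa)
  show "Group.monoid (completed_path_algebra n)"
  proof (rule monoidI)
    fix f g assume fg: "f \<in> carrier (completed_path_algebra n)" "g \<in> carrier (completed_path_algebra n)"
    show "f \<otimes>\<^bsub>completed_path_algebra n\<^esub> g \<in> carrier (completed_path_algebra n)"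
      unfolding carrier_cpa mult_cpa
    proof clarify
      fix as i assume "\<not> is_path n (as, i)"
      then have "f (split_left n (as, i) m) * g (split_right (as, i) m) = 0" for m
        using fg is_path_split[of n "(as, i)" m] unfolding carrier_cpa by auto
      then show "(\<Sum>m\<le>length (fst (as, i)). f (split_left n (as, i) m) * g (split_right (as, i) m)) = 0"
        by (intro sum.neutral) blast
    qed
  qed (use is_path_source in \<open>auto simp: cpa_mult_assoc cpa_one_mult cpa_mult_one, auto simp: carrier_cpa one_cpa\<close>)
qed (auto simp: mult_cpa add_cpa algebra_simps sum.distrib)

text \<open>Only the cut at position \<open>length us\<close> can contribute, and there the
  assumption makes the starting vertex \<open>j\<close> of the left factor match.\<close>

lemma single_mult_single:
  assumes "path_target n (ws, i) = j"
  shows "single (us, j) \<otimes>\<^bsub>completed_path_algebra n\<^esub> single (ws, i) = single (us @ ws, i)"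
proof (rule ext, clarify)
  fix as i'
  have "(single (us, j) \<otimes>\<^bsub>completed_path_algebra n\<^esub> single (ws, i)) (as, i') =
      (\<Sum>m\<le>length as. if m = length us then single (us @ ws, i) (as, i') else 0)"
    unfolding mult_cpa
  proof (rule sum.cong)
    fix m assume m: "m \<in> {..length as}"
    then show "single (us, j) (split_left n (as, i') m) * single (ws, i) (split_right (as, i') m) =
        (if m = length us then single (us @ ws, i) (as, i') else 0)"
    proof (cases "as = us @ ws \<and> m = length us")
      case True
      then show ?thesis using assms by (auto simp: single_def)
    next
      case False
      moreover have "as = take m as @ drop m as" "length (take m as) = m"
        using m by simp_all
      ultimately have "take m as \<noteq> us \<or> drop m as \<noteq> ws" and "m = length us \<Longrightarrow> as \<noteq> us @ ws"
        by metis+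
      then show ?thesis by (auto simp: single_def)
    qed
  qed simp
  also have "\<dots> = single (us @ ws, i) (as, i')"
    by (auto simp: single_def)
  finally show "(single (us, j) \<otimes>\<^bsub>completed_path_algebra n\<^esub> single (ws, i)) (as, i') =
      single (us @ ws, i) (as, i')" .
qed

lemma cpa_mult_diff_right:
  "f \<otimes>\<^bsub>completed_path_algebra n\<^esub> (\<lambda>p. g p - h p) =
   (\<lambda>p. (f \<otimes>\<^bsub>completed_path_algebra n\<^esub> g) p - (f \<otimes>\<^bsub>completed_path_algebra n\<^esub> h) p)"
  by (simp add: mult_cpa right_diff_distrib sum_subtractf)

lemma cpa_mult_diff_left:
  "(\<lambda>p. g p - h p) \<otimes>\<^bsub>completed_path_algebra n\<^esub> f =
   (\<lambda>p. (g \<otimes>\<^bsub>completed_path_algebra n\<^esub> f) p - (h \<otimes>\<^bsub>completed_path_algebra n\<^esub> f) p)"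
  by (simp add: mult_cpa left_diff_distrib sum_subtractf)

lemma single_carrier: "is_path n p \<Longrightarrow> single p \<in> carrier (completed_path_algebra n)"
  by (auto simp: carrier_cpa single_def)

text \<open>The ring record carries no scalars, so a complex multiple is expressed as a product with
  a multiple of the unit. This turns ring ideals into complex subspaces.\<close>

lemma cpa_scale:
  assumes "f \<in> carrier (completed_path_algebra n)"
  shows "(\<lambda>p. c * \<one>\<^bsub>completed_path_algebra n\<^esub> p) \<otimes>\<^bsub>completed_path_algebra n\<^esub> f = (\<lambda>p. c * f p)"
proof -
  have "(\<lambda>p. c * \<one>\<^bsub>completed_path_algebra n\<^esub> p) \<otimes>\<^bsub>completed_path_algebra n\<^esub> f =
      (\<lambda>p. c * (\<one>\<^bsub>completed_path_algebra n\<^esub> \<otimes>\<^bsub>completed_path_algebra n\<^esub> f) p)"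
    by (simp add: mult_cpa sum_distrib_left mult.assoc)
  then show ?thesis using cpa_one_mult[OF assms] by simp
qed

lemma cpa_ideal_lincomb:
  assumes J: "ideal J (completed_path_algebra n)" and fin: "finite T" and T: "\<And>p. p \<in> T \<Longrightarrow> g p \<in> J"
  shows "(\<lambda>q. \<Sum>p\<in>T. c p * g p q) \<in> J"
  using fin T
proof (induction T)
  case empty
  then show ?case
    using additive_subgroup.zero_closed[OF ideal.axioms(1)[OF J]] by (simp add: zero_cpa)
next
  case (insert p T)
  interpret ideal J "completed_path_algebra n" by fact
  have "(\<lambda>q. c p * \<one>\<^bsub>completed_path_algebra n\<^esub> q) \<in> carrier (completed_path_algebra n)"
    using one_closed by (auto simp: carrier_cpa)
  from I_l_closed[OF _ this, of "g p"] have "(\<lambda>q. c p * g p q) \<in> J"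
    using insert.prems by (simp add: cpa_scale)
  moreover have "(\<lambda>q. \<Sum>p\<in>T. c p * g p q) \<in> J"
    using insert by blast
  ultimately have "(\<lambda>q. c p * g p q) \<oplus>\<^bsub>completed_path_algebra n\<^esub> (\<lambda>q. \<Sum>p\<in>T. c p * g p q) \<in> J"
    by (rule additive_subgroup.a_closed[OF is_additive_subgroup])
  with insert.hyps show ?case
    by (simp add: add_cpa)
qed

section \<open>The symbol of an element\<close>

locale k_subset_family =
  fixes k n s :: nat and I :: "nat \<Rightarrow> nat set"
  assumes k_pos: "0 < k" and k_less: "k < n" and s_pos: "0 < s"
    and I_subset: "j \<in> {1..s} \<Longrightarrow> I j \<subseteq> {1..n}"
    and I_card: "j \<in> {1..s} \<Longrightarrow> card (I j) = k"
begin

lemma n_pos: "0 < n"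
  using k_less by simp

abbreviation A :: "(path \<Rightarrow> complex) ring" where "A \<equiv> completed_path_algebra n"

lemma r_num_le: "r_num s I i \<le> s"
  unfolding r_num_def by (rule order_trans[OF card_mono[of "{1..s}"]]) auto

text \<open>Double counting of the pairs \<open>(i, j)\<close> with
  \<open>i \<in> I j\<close>.\<close>

lemma sum_r_num: "(\<Sum>i\<in>{1..n}. r_num s I i) = s * k"
proof -
  have "(\<Sum>i\<in>{1..n}. r_num s I i) = (\<Sum>i\<in>{1..n}. \<Sum>j\<in>{1..s}. if i \<in> I j then 1 else 0)"
    unfolding r_num_def by (intro sum.cong refl) (simp add: sum.If_cases Int_def)
  also have "\<dots> = (\<Sum>j\<in>{1..s}. \<Sum>i\<in>{1..n}. if i \<in> I j then 1 else 0)"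
    by (rule sum.swap)
  also have "\<dots> = (\<Sum>j\<in>{1..s}. k)"
  proof (intro sum.cong refl)
    fix j assume j: "j \<in> {1..s}"
    then have "{1..n} \<inter> I j = I j" using I_subset by auto
    then show "(\<Sum>i\<in>{1..n}. if i \<in> I j then 1 else 0) = k"
      using I_card[OF j] by (simp add: sum.If_cases)
  qed
  finally show ?thesis by simp
qed

section \<open>Comparison of weight, degree and length of paths\<close>

primrec wt :: "arrow \<Rightarrow> nat" where
  "wt (X i) = s - r_num s I i"
| "wt (Y i) = r_num s I i"

definition path_wt :: "path \<Rightarrow> nat" where
  "path_wt p = (\<Sum>a\<leftarrow>fst p. wt a)"

text \<open>A grading that makes both relations homogeneous: \<open>x^k\<close> and
  \<open>y^(n-k)\<close> both have degree \<open>k * (n - k)\<close>. In contrast to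
  \<open>wt\<close> it does not depend on the sets \<open>I j\<close>.\<close>

primrec deg :: "arrow \<Rightarrow> nat" where
  "deg (X i) = n - k"
| "deg (Y i) = k"

definition path_deg :: "path \<Rightarrow> nat" where
  "path_deg p = (\<Sum>a\<leftarrow>fst p. deg a)"

lemma path_wt_append: "path_wt (us @ ws, i) = path_wt (us, j) + path_wt (ws, l)"
  by (simp add: path_wt_def)

text \<open>The summand is the defect \<open>n * wt (X l) - s * deg (X l)\<close>, so these partial
  sums form a potential on the vertices for the difference between weight and degree.\<close>

definition height :: "nat \<Rightarrow> int" where
  "height i = (\<Sum>l\<in>{1..i}. int (s * k) - int n * int (r_num s I l))"

text \<open>By \<open>sum_r_num\<close> the defects cancel around the cycle. Hence the potential is
  consistent modulo \<open>n\<close>: the predecessor of vertex 1 is \<open>n\<close>, and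
  \<open>height n\<close> agrees with \<open>height 0\<close>.\<close>

lemma height_n: "height n = 0"
proof -
  have "(\<Sum>l\<in>{1..n}. int (r_num s I l)) = int (s * k)"
    by (simp flip: sum_r_num)
  then show ?thesis
    by (simp add: height_def sum_subtractf flip: sum_distrib_left)
qed

lemma vtx_pred: "i \<in> {1..n} \<Longrightarrow> vtx n (int i - 1) = (if i = 1 then n else i - 1)"
proof -
  assume i: "i \<in> {1..n}"
  show ?thesis
  proof (cases "i = 1")
    case True
    then have "vtx n (int i - 1) = vtx n (int n)" by (intro vtx_cong) simp
    then show ?thesis using True n_pos by (simp add: vtx_of_nat)
  next
    case False
    then have "vtx n (int i - 1) = vtx n (int (i - 1))" using i by (simp add: of_nat_diff)
    then show ?thesis using i False by (subst (asm) vtx_of_nat) auto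
  qed
qed

lemma height_step:
  "i \<in> {1..n} \<Longrightarrow> height i - height (vtx n (int i - 1)) = int (s * k) - int n * int (r_num s I i)"
proof -
  assume i: "i \<in> {1..n}"
  have "height i = height (i - 1) + (int (s * k) - int n * int (r_num s I i))"
    using i unfolding height_def by (cases i) auto
  moreover have "height 0 = 0" by (simp add: height_def)
  ultimately show ?thesis
    using i by (auto simp: vtx_pred height_n)
qed

text \<open>Up to a coboundary on the quiver, the weight is proportional to the degree, for which the
  arrows \<open>x\<close> and \<open>y\<close> have degrees \<open>n - k\<close> and \<open>k\<close>.\<close>

lemma wt_deg_arrow:
  assumes "a \<in> arrows n"
  shows "int n * int (wt a) =
    int s * int (deg a) + height (arrow_target n a) - height (arrow_source n a)"
proof (cases a)
  case (X i)
  then have "i \<in> {1..n}" using assms by (auto simp: arrows_def)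
  from height_step[OF this] show ?thesis
    using X r_num_le[of i] k_less by (simp add: of_nat_diff algebra_simps)
next
  case (Y i)
  then have "i \<in> {1..n}" using assms by (auto simp: arrows_def)
  from height_step[OF this] show ?thesis
    using Y by (simp add: algebra_simps)
qed

text \<open>The heights telescope along the path. So among paths with fixed endpoints, weight and
  degree determine each other.\<close>

lemma wt_deg:
  "is_path n p \<Longrightarrow>
    int n * int (path_wt p) = int s * int (path_deg p) + height (path_target n p) - height (snd p)"
proof (cases p)
  case (Pair as i)
  assume "is_path n p"
  then have "is_path n (as, i)" using Pair by simp
  then have "int n * int (path_wt (as, i)) =
      int s * int (path_deg (as, i)) + height (path_target n (as, i)) - height i"
  proof (induction as)
    case (Cons a as)
    then have "int n * int (wt a) = int s * int (deg a) + height (arrow_target n a) - height (path_target n (as, i))"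
      using wt_deg_arrow[of a] by simp
    with Cons show ?case
      by (simp add: path_wt_def path_deg_def algebra_simps)
  qed (simp add: path_wt_def path_deg_def)
  then show ?thesis using Pair by simp
qed

lemma length_le_deg: "length (fst p) \<le> path_deg p"
proof -
  have deg: "1 \<le> deg a" for a using k_pos k_less by (cases a) auto
  have "length as \<le> (\<Sum>a\<leftarrow>as. deg a)" for as :: "arrow list"
  proof (induction as)
    case (Cons a as)
    then show ?case using deg[of a] unfolding list.map sum_list.Cons list.size by linarith
  qed simp
  then show ?thesis by (simp add: path_deg_def)
qed

definition len_bound :: "nat \<Rightarrow> nat" where
  "len_bound d = n * d + nat (2 * (\<Sum>i\<in>{1..n}. \<bar>height i\<bar>)) + 1"

text \<open>An arrow may have weight 0, so the weight does not bound the length directly. But every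
  arrow has degree at least 1, and \<open>wt_deg\<close> bounds the degree by the weight up to the
  heights of the two endpoints, which the second term of \<open>len_bound\<close> absorbs.\<close>

lemma length_less_len_bound:
  assumes "is_path n p" "path_wt p \<le> d"
  shows "length (fst p) < len_bound d"
proof -
  define C where "C = (\<Sum>i\<in>{1..n}. \<bar>height i\<bar>)"
  have C: "\<bar>height i\<bar> \<le> C" if "i \<in> {1..n}" for i
    unfolding C_def using that by (intro member_le_sum) auto
  have "path_target n p \<in> {1..n}" "snd p \<in> {1..n}"
    using assms(1) is_path_target is_path_source[of n "fst p" "snd p"] by auto
  from C[OF this(1)] C[OF this(2)] wt_deg[OF assms(1)]
  have "int s * int (path_deg p) \<le> int n * int (path_wt p) + 2 * C" by linarith
  also have "\<dots> \<le> int n * int d + 2 * C"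
    using assms(2) by (intro add_right_mono mult_left_mono) auto
  finally have "int s * int (path_deg p) \<le> int n * int d + 2 * C" .
  moreover have "int (path_deg p) \<le> int s * int (path_deg p)"
    using s_pos by (simp add: mult_le_cancel_right1)
  moreover have "int (length (fst p)) \<le> int (path_deg p)"
    using length_le_deg by simp
  ultimately have "int (length (fst p)) \<le> int n * int d + 2 * C" by linarith
  moreover have "0 \<le> C" unfolding C_def by (rule sum_nonneg) simp
  ultimately show ?thesis unfolding len_bound_def C_def[symmetric]
    by (simp add: nat_less_iff zless_nat_eq_int_zless flip: of_nat_mult)
qed

lemma finite_wt_le: "finite {p. is_path n p \<and> path_wt p \<le> d}"
  by (rule finite_subset[OF _ finite_paths[of n "len_bound d"]]) (auto intro: length_less_len_bound)

section \<open>The matrix of power series attached to an element, and its multiplicativity\<close>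

definition paths :: "nat \<Rightarrow> nat \<Rightarrow> nat \<Rightarrow> path set" where
  "paths j i d = {p. is_path n p \<and> path_target n p = j \<and> snd p = i \<and> path_wt p = d}"

lemma finite_paths_wt: "finite (paths j i d)"
  by (rule finite_subset[OF _ finite_wt_le[of d]]) (auto simp: paths_def)

text \<open>The row index \<open>j\<close> is the target and the column index \<open>i\<close> the
  source, in accordance with the order of composition. The coefficients are finite sums by
  \<open>finite_paths_wt\<close>.\<close>

definition symbol :: "(path \<Rightarrow> complex) \<Rightarrow> nat \<Rightarrow> nat \<Rightarrow> complex fps" where
  "symbol f j i = Abs_fps (\<lambda>d. \<Sum>p\<in>paths j i d. f p)"

lemma symbol_nth: "fps_nth (symbol f j i) d = (\<Sum>p\<in>paths j i d. f p)"
  by (simp add: symbol_def)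

lemma symbol_add: "symbol (f \<oplus>\<^bsub>A\<^esub> g) j i = symbol f j i + symbol g j i"
  by (rule fps_ext) (simp add: symbol_nth add_cpa sum.distrib)

lemma symbol_diff: "symbol (\<lambda>p. f p - g p) j i = symbol f j i - symbol g j i"
  by (rule fps_ext) (simp add: symbol_nth sum_subtractf)

lemma symbol_zero: "symbol \<zero>\<^bsub>A\<^esub> j i = 0"
  by (rule fps_ext) (simp add: symbol_nth zero_cpa)

lemma symbol_single:
  "is_path n p \<Longrightarrow> symbol (single p) j i = (if path_target n p = j \<and> snd p = i then fps_X ^ path_wt p else 0)"
proof (rule fps_ext)
  fix d assume "is_path n p"
  then have "(p \<in> paths j i d) \<longleftrightarrow> path_target n p = j \<and> snd p = i \<and> path_wt p = d"
    by (simp add: paths_def)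
  then show "fps_nth (symbol (single p) j i) d =
      fps_nth (if path_target n p = j \<and> snd p = i then fps_X ^ path_wt p else 0) d"
    by (auto simp: symbol_nth single_def finite_paths_wt)
qed

lemma symbol_one:
  "i \<in> {1..n} \<Longrightarrow> symbol \<one>\<^bsub>A\<^esub> j i = (if j = i then 1 else 0)"
proof (rule fps_ext)
  fix d assume i: "i \<in> {1..n}"
  have "fps_nth (symbol \<one>\<^bsub>A\<^esub> j i) d = (\<Sum>p\<in>paths j i d. if p = ([], i) then 1 else 0)"
    unfolding symbol_nth using i by (intro sum.cong) (auto simp: one_cpa paths_def)
  also have "\<dots> = fps_nth (if j = i then 1 else 0) d"
    using i finite_paths_wt[of j i d] by (auto simp: paths_def path_wt_def)
  finally show "fps_nth (symbol \<one>\<^bsub>A\<^esub> j i) d = fps_nth (if j = i then 1 else 0) d" .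
qed

text \<open>Cutting is a bijection from paths with a marked position to composable pairs of paths;
  \<open>C\<close> collects the pairs with the prescribed outer endpoints and total weight
  \<open>d\<close>.\<close>

lemma symbol_mult:
  "symbol (f \<otimes>\<^bsub>A\<^esub> g) l i = (\<Sum>j\<in>{1..n}. symbol f l j * symbol g j i)"
proof (rule fps_ext)
  fix d
  define C where "C = {(u, w). is_path n u \<and> is_path n w \<and> path_target n w = snd u \<and>
      path_target n u = l \<and> snd w = i \<and> path_wt u + path_wt w = d}"
  have finC: "finite C"
    by (rule finite_subset[OF _ finite_cartesian_product[OF finite_wt_le[of d] finite_wt_le[of d]]])
      (auto simp: C_def)
  have "fps_nth (symbol (f \<otimes>\<^bsub>A\<^esub> g) l i) d =
      (\<Sum>(p, m)\<in>Sigma (paths l i d) (\<lambda>p. {..length (fst p)}). f (split_left n p m) * g (split_right p m))"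
    unfolding symbol_nth mult_cpa by (rule sum.Sigma) (auto simp: finite_paths_wt)
  also have "\<dots> = (\<Sum>(u, w)\<in>C. f u * g w)"
  proof (rule sum.reindex_bij_witness[of _ "\<lambda>(u, w). ((fst u @ fst w, i), length (fst u))"
        "\<lambda>(p, m). (split_left n p m, split_right p m)"], goal_cases)
    case (1 a)
    then show ?case by (auto simp: paths_def)
  next
    case (2 a)
    then obtain p m where a: "a = (p, m)" and p: "is_path n p" "path_target n p = l" "snd p = i"
        "path_wt p = d" and m: "m \<le> length (fst p)"
      by (auto simp: paths_def)
    have "path_target n p = path_target n (split_left n p m)"
      using path_target_append[of n "take m (fst p)" "drop m (fst p)" "snd p"] by simp
    moreover have "path_wt p = path_wt (split_left n p m) + path_wt (split_right p m)"
      using path_wt_append[of "take m (fst p)" "drop m (fst p)" "snd p"] by (simp add: path_wt_def)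
    ultimately show ?case
      using a p is_path_split[of n p m] by (auto simp: C_def)
  next
    case (3 b)
    then show ?case by (auto simp: C_def)
  next
    case (4 b)
    then show ?case
      by (auto simp: C_def paths_def is_path_append path_wt_def)
  qed auto
  \<comment> \<open>Pairs are grouped by the middle vertex, which gives the matrix product, and by
    the weight of the left factor, which gives the product of power series.\<close>
  also have "\<dots> = (\<Sum>y\<in>{1..n} \<times> {0..d}. \<Sum>x\<in>{x \<in> C. (snd (fst x), path_wt (fst x)) = y}. case x of (u, w) \<Rightarrow> f u * g w)"
  proof (rule sum.group[symmetric, OF finC])
    show "(\<lambda>x. (snd (fst x), path_wt (fst x))) ` C \<subseteq> {1..n} \<times> {0..d}"
      using is_path_target by (force simp: C_def)
  qed simp
  also have "\<dots> = (\<Sum>(j, a)\<in>{1..n} \<times> {0..d}. (\<Sum>u\<in>paths l j a. f u) * (\<Sum>w\<in>paths j i (d - a). g w))"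
  proof (rule sum.cong[OF refl], clarify)
    fix j a assume a: "a \<in> {0..d}"
    then have "{x \<in> C. (snd (fst x), path_wt (fst x)) = (j, a)} = paths l j a \<times> paths j i (d - a)"
      by (auto simp: C_def paths_def)
    then show "(\<Sum>x\<in>{x \<in> C. (snd (fst x), path_wt (fst x)) = (j, a)}. case x of (u, w) \<Rightarrow> f u * g w) =
        (\<Sum>u\<in>paths l j a. f u) * (\<Sum>w\<in>paths j i (d - a). g w)"
      by (simp add: sum_product sum.cartesian_product)
  qed
  also have "\<dots> = fps_nth (\<Sum>j\<in>{1..n}. symbol f l j * symbol g j i) d"
    by (simp add: fps_sum_nth fps_mult_nth symbol_nth sum.cartesian_product)
  finally show "fps_nth (symbol (f \<otimes>\<^bsub>A\<^esub> g) l i) d =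
      fps_nth (\<Sum>j\<in>{1..n}. symbol f l j * symbol g j i) d" .
qed

end

section \<open>The action on \<open>L\<close>\<close>

context
  fixes s :: nat
  assumes s_pos: "0 < s"
begin

lemma sigma_mat_carrier [simp]: "sigma_mat s \<in> carrier_mat s s"
  by (simp add: sigma_mat_def)

lemma sigma_mult_vec_index:
  assumes v: "v \<in> carrier_vec s" and a: "a < s"
  shows "(sigma_mat s *\<^sub>v v) $ a = (if a = s - 1 then fps_X * v $ 0 else v $ (a + 1))"
proof -
  have "(sigma_mat s *\<^sub>v v) $ a = (\<Sum>b\<in>{0..<s}. sigma_mat s $$ (a, b) * v $ b)"
    using v a by (auto simp: scalar_prod_def sigma_mat_def)
  also have "\<dots> = (\<Sum>b\<in>{0..<s}. (if b = a + 1 then v $ b else 0) +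
      (if b = 0 then (if a = s - 1 then fps_X * v $ b else 0) else 0))"
    using a by (intro sum.cong refl) (auto simp: sigma_mat_def)
  also have "\<dots> = (if a = s - 1 then fps_X * v $ 0 else v $ (a + 1))"
    using a s_pos by (auto simp: sum.distrib)
  finally show ?thesis .
qed

text \<open>\<open>\<complex>[[t]]\<^sup>s\<close> is identified with \<open>\<complex>[[u]]\<close>, where \<open>t = u\<^sup>s\<close> and the basis vector with index \<open>c\<close>
  (counted from \<open>0\<close>) corresponds to \<open>u\<^sup>s\<^sup>-\<^sup>1\<^sup>-\<^sup>c\<close>. Then \<open>\<sigma>\<close> becomes multiplication by \<open>u\<close>.\<close>

definition enc :: "complex fps vec \<Rightarrow> complex fps" where
  "enc v = Abs_fps (\<lambda>d. fps_nth (v $ (s - 1 - d mod s)) (d div s))"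

definition dec :: "complex fps \<Rightarrow> complex fps vec" where
  "dec w = vec s (\<lambda>c. Abs_fps (\<lambda>m. fps_nth w (m * s + (s - 1 - c))))"

lemma enc_nth: "fps_nth (enc v) d = fps_nth (v $ (s - 1 - d mod s)) (d div s)"
  by (simp add: enc_def)

lemma dec_carrier: "dec w \<in> carrier_vec s"
  by (simp add: dec_def)

lemma enc_dec: "enc (dec w) = w"
proof (rule fps_ext)
  fix d
  have "d mod s < s" using s_pos by simp
  then show "fps_nth (enc (dec w)) d = fps_nth w d"
    by (simp add: enc_nth dec_def)
qed

lemma enc_nth_index: "c < s \<Longrightarrow> fps_nth (enc v) (m * s + (s - 1 - c)) = fps_nth (v $ c) m"
proof -
  assume "c < s"
  then have "(m * s + (s - 1 - c)) mod s = s - 1 - c" "(m * s + (s - 1 - c)) div s = m"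
    by (simp_all only: mod_mult_self3 div_mult_self3) auto
  then show ?thesis using \<open>c < s\<close> by (simp only: enc_nth) simp
qed

lemma enc_inject:
  assumes "v \<in> carrier_vec s" "w \<in> carrier_vec s" and eq: "enc v = enc w"
  shows "v = w"
proof (rule eq_vecI)
  fix c assume "c < dim_vec w"
  then have "c < s" using assms by simp
  then show "v $ c = w $ c"
    using enc_nth_index[of c v] enc_nth_index[of c w] eq by (simp add: fps_eq_iff)
qed (use assms in simp)

lemma enc_add:
  "v \<in> carrier_vec s \<Longrightarrow> w \<in> carrier_vec s \<Longrightarrow> enc (v + w) = enc v + enc w"
  by (rule fps_ext) (use s_pos in \<open>auto simp: enc_nth\<close>)

lemma enc_zero: "enc (0\<^sub>v s) = 0"
  by (rule fps_ext) (use s_pos in \<open>auto simp: enc_nth\<close>)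

lemma enc_sigma:
  assumes v: "v \<in> carrier_vec s"
  shows "enc (sigma_mat s *\<^sub>v v) = fps_X * enc v"
proof (rule fps_ext)
  fix d
  have lt: "s - 1 - d mod s < s" using s_pos by simp
  have mod_lt: "d mod s < s" using s_pos by simp
  have "fps_nth (enc (sigma_mat s *\<^sub>v v)) d =
      fps_nth (if s - 1 - d mod s = s - 1 then fps_X * v $ 0 else v $ (s - 1 - d mod s + 1)) (d div s)"
    unfolding enc_nth by (subst sigma_mult_vec_index[OF v lt]) simp
  also have "\<dots> = (if d = 0 then 0 else fps_nth (enc v) (d - 1))"
  \<comment> \<open>If \<open>s\<close> divides \<open>d\<close>, the last row of
    \<open>sigma_mat s\<close> is concerned, which multiplies entry 0 by \<open>t\<close>: for
    \<open>d > 0\<close>, lowering \<open>d\<close> by 1 moves to residue \<open>s - 1\<close> and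
    lowers the quotient by 1. Otherwise the vector index grows by 1 and the quotient stays the
    same.\<close>
  proof (cases "d mod s = 0")
    case True
    then obtain q where q: "d = s * q" by blast
    show ?thesis
    proof (cases q)
      case (Suc q')
      then have "d - 1 = q' * s + (s - 1)" using q s_pos by (simp add: mult.commute)
      moreover have "(q' * s + (s - 1)) mod s = s - 1" "(q' * s + (s - 1)) div s = q'"
        using s_pos by (simp_all only: mod_mult_self3 div_mult_self3[OF gr_implies_not0[OF s_pos]]) auto
      ultimately show ?thesis using Suc q s_pos True by (simp add: enc_nth)
    qed (use q in simp)
  next
    case False
    then obtain r where r: "d mod s = Suc r" by (cases "d mod s") auto
    define q where "q = d div s"
    have "d = q * s + Suc r" unfolding q_def r[symmetric] by simp
    moreover have "r < s" using mod_lt r by simp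
    ultimately have "(d - 1) mod s = r" "(d - 1) div s = q" by auto
    then show ?thesis
      using False r mod_lt by (auto simp: enc_nth q_def Suc_diff_Suc)
  qed
  finally show "fps_nth (enc (sigma_mat s *\<^sub>v v)) d = fps_nth (fps_X * enc v) d"
    by simp
qed

lemma enc_sigma_power:
  assumes "v \<in> carrier_vec s"
  shows "(sigma_mat s ^\<^sub>m m) *\<^sub>v v \<in> carrier_vec s \<and>
    enc ((sigma_mat s ^\<^sub>m m) *\<^sub>v v) = fps_X ^ m * enc v"
  using assms
proof (induction m arbitrary: v)
  case 0
  moreover have "dim_row (sigma_mat s) = s" by (simp add: sigma_mat_def)
  ultimately show ?case by simp
next
  case (Suc m)
  have "(sigma_mat s ^\<^sub>m Suc m) *\<^sub>v v = (sigma_mat s ^\<^sub>m m) *\<^sub>v (sigma_mat s *\<^sub>v v)"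
    using Suc.prems by (simp add: assoc_mult_mat_vec[where ?n\<^sub>1 = s and ?n\<^sub>2 = s and ?n\<^sub>3 = s])
  moreover have "sigma_mat s *\<^sub>v v \<in> carrier_vec s"
    using Suc.prems by (rule mult_mat_vec_carrier[OF sigma_mat_carrier])
  ultimately show ?case
    using Suc.IH[of "sigma_mat s *\<^sub>v v"] enc_sigma[OF Suc.prems] by (simp add: ac_simps)
qed

text \<open>The embedding \<open>P(t) \<mapsto> P(u\<^sup>s)\<close>.\<close>

definition stretch :: "complex fps \<Rightarrow> complex fps" where
  "stretch P = Abs_fps (\<lambda>d. if s dvd d then fps_nth P (d div s) else 0)"

lemma stretch_nth: "fps_nth (stretch P) d = (if s dvd d then fps_nth P (d div s) else 0)"
  by (simp add: stretch_def)

lemma stretch_inject: "stretch P = stretch Q \<Longrightarrow> P = Q"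
proof (rule fps_ext)
  fix d assume "stretch P = stretch Q"
  then have "fps_nth (stretch P) (d * s) = fps_nth (stretch Q) (d * s)" by simp
  then show "fps_nth P d = fps_nth Q d" using s_pos by (simp add: stretch_nth)
qed

text \<open>Only exponents divisible by \<open>s\<close> occur in \<open>stretch P\<close>, and
  subtracting them from \<open>d\<close> keeps the residue modulo \<open>s\<close>. The convolution
  therefore stays within one entry of \<open>v\<close>, where it is the ordinary product.\<close>

lemma enc_smult:
  assumes v: "v \<in> carrier_vec s"
  shows "enc (P \<cdot>\<^sub>v v) = stretch P * enc v"
proof (rule fps_ext)
  fix d
  define q where "q = d div s"
  have lt: "s - 1 - d mod s < s" using s_pos by simp
  have "fps_nth (stretch P * enc v) d =
      (\<Sum>a\<in>{a. a \<le> d \<and> s dvd a}. fps_nth P (a div s) * fps_nth (enc v) (d - a))"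
    unfolding fps_mult_nth by (rule sum.mono_neutral_cong_right) (auto simp: stretch_nth)
  also have "\<dots> = (\<Sum>b\<in>{0..q}. fps_nth P b * fps_nth (enc v) (d - b * s))"
  proof (rule sum.reindex_bij_witness[of _ "\<lambda>b. b * s" "\<lambda>a. a div s"])
    fix b assume "b \<in> {0..q}"
    then show "b * s \<in> {a. a \<le> d \<and> s dvd a}"
      using s_pos by (simp add: q_def less_eq_div_iff_mult_less_eq)
  qed (use s_pos in \<open>auto simp: q_def div_le_mono\<close>)
  also have "\<dots> = (\<Sum>b\<in>{0..q}. fps_nth P b * fps_nth (v $ (s - 1 - d mod s)) (q - b))"
  proof (intro sum.cong refl)
    fix b assume "b \<in> {0..q}"
    then have "b * s \<le> d" using s_pos by (simp add: q_def less_eq_div_iff_mult_less_eq)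
    then obtain e where e: "d = e + b * s" by (metis le_add_diff_inverse2)
    then show "fps_nth P b * fps_nth (enc v) (d - b * s) =
        fps_nth P b * fps_nth (v $ (s - 1 - d mod s)) (q - b)"
      using s_pos by (simp add: enc_nth q_def)
  qed
  also have "\<dots> = fps_nth (enc (P \<cdot>\<^sub>v v)) d"
    using v lt by (simp add: enc_nth fps_mult_nth q_def)
  finally show "fps_nth (enc (P \<cdot>\<^sub>v v)) d = fps_nth (stretch P * enc v) d" by simp
qed

end

context k_subset_family
begin

section \<open>The action of single paths and of infinite combinations, seen through the
  encoding\<close>

abbreviation enc_s :: "complex fps vec \<Rightarrow> complex fps" where "enc_s \<equiv> enc s"

lemma enc_L_arrow:
  "v \<in> carrier_vec s \<Longrightarrow> L_arrow s I a *\<^sub>v v \<in> carrier_vec s \<and>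
    enc_s (L_arrow s I a *\<^sub>v v) = fps_X ^ wt a * enc_s v"
  using enc_sigma_power[OF s_pos] by (cases a) auto

lemma enc_L_path:
  assumes v: "v \<in> carrier_vec s"
  shows "enc_s (L_path s I p v) = fps_X ^ path_wt p * enc_s v"
proof -
  have "L_path s I (as, i) v \<in> carrier_vec s \<and>
      enc_s (L_path s I (as, i) v) = fps_X ^ path_wt (as, i) * enc_s v" for as i
  proof (induction as)
    case (Cons a as)
    then show ?case
      using enc_L_arrow[of "L_path s I (as, i) v" a]
      by (auto simp: L_path_def path_wt_def power_add mult.assoc)
  qed (use v in \<open>simp add: L_path_def path_wt_def\<close>)
  then show ?thesis by (metis surj_pair)
qed

text \<open>Each coefficient of the limit receives contributions only from paths of bounded weight,
  hence of bounded length, so the truncated sums are eventually constant in that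
  coefficient.\<close>

lemma L_act_eq:
  assumes v: "v \<in> {1..n} \<rightarrow> carrier_vec s" and j: "j \<in> {1..n}"
  shows "L_act n s I f v j = dec s (\<Sum>i\<in>{1..n}. symbol f j i * enc_s (v i))"
proof -
  define T where "T = (\<Sum>i\<in>{1..n}. symbol f j i * enc_s (v i))"
  define S where "S d = {p. is_path n p \<and> path_target n p = j \<and> path_wt p \<le> d}" for d
  have T_nth: "fps_nth T d = (\<Sum>p\<in>S d. f p * fps_nth (enc_s (v (snd p))) (d - path_wt p))" for d
  proof -
    have "fps_nth T d = (\<Sum>(i, a)\<in>{1..n} \<times> {0..d}. \<Sum>p\<in>paths j i a. f p * fps_nth (enc_s (v i)) (d - a))"
      by (simp add: T_def fps_sum_nth fps_mult_nth symbol_nth sum_distrib_right sum.cartesian_product)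
    also have "\<dots> = (\<Sum>y\<in>{1..n} \<times> {0..d}. \<Sum>p\<in>{p \<in> S d. (snd p, path_wt p) = y}.
        f p * fps_nth (enc_s (v (snd p))) (d - path_wt p))"
      by (intro sum.cong refl) (auto simp: S_def paths_def intro!: sum.cong)
    also have "\<dots> = (\<Sum>p\<in>S d. f p * fps_nth (enc_s (v (snd p))) (d - path_wt p))"
    proof (rule sum.group)
      show "finite (S d)"
        by (rule finite_subset[OF _ finite_wt_le[of d]]) (auto simp: S_def)
      show "(\<lambda>p. (snd p, path_wt p)) ` S d \<subseteq> {1..n} \<times> {0..d}"
        using is_path_source by (force simp: S_def)
    qed simp
    finally show ?thesis .
  qed
  have "lim (\<lambda>N. \<Sum>p\<in>{p. is_path n p \<and> path_target n p = j \<and> length (fst p) < N}.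
          fps_const (f p) * (L_path s I p (v (snd p)) $ c)) = dec s T $ c" if c: "c < s" for c
  proof (rule limI, rule tendsto_fpsI)
    fix m
    \<comment> \<open>The exponent in the encoding that corresponds to coefficient \<open>m\<close>
      of entry \<open>c\<close>.\<close>
    define d where "d = m * s + (s - 1 - c)"
    have "fps_nth (\<Sum>p\<in>{p. is_path n p \<and> path_target n p = j \<and> length (fst p) < N}.
          fps_const (f p) * (L_path s I p (v (snd p)) $ c)) m = fps_nth (dec s T $ c) m"
      if N: "N \<ge> len_bound d" for N
    proof -
      have "fps_nth (\<Sum>p\<in>{p. is_path n p \<and> path_target n p = j \<and> length (fst p) < N}.
          fps_const (f p) * (L_path s I p (v (snd p)) $ c)) m =
        (\<Sum>p\<in>{p. is_path n p \<and> path_target n p = j \<and> length (fst p) < N}.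
          f p * (if d < path_wt p then 0 else fps_nth (enc_s (v (snd p))) (d - path_wt p)))"
        unfolding fps_sum_nth
      proof (intro sum.cong refl)
        fix p assume "p \<in> {p. is_path n p \<and> path_target n p = j \<and> length (fst p) < N}"
        then have "v (snd p) \<in> carrier_vec s"
          using v is_path_source[of n "fst p" "snd p"] by (auto simp: Pi_iff)
        then show "fps_nth (fps_const (f p) * (L_path s I p (v (snd p)) $ c)) m =
            f p * (if d < path_wt p then 0 else fps_nth (enc_s (v (snd p))) (d - path_wt p))"
          using enc_nth_index[OF s_pos c, of "L_path s I p (v (snd p))" m]
          by (auto simp: enc_L_path fps_X_power_mult_nth d_def split: if_splits)
      qed
      also have "\<dots> = (\<Sum>p\<in>S d. f p * fps_nth (enc_s (v (snd p))) (d - path_wt p))"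
      proof (rule sum.mono_neutral_cong_right)
        show "finite {p. is_path n p \<and> path_target n p = j \<and> length (fst p) < N}"
          by (rule finite_subset[OF _ finite_paths[of n N]]) auto
        show "S d \<subseteq> {p. is_path n p \<and> path_target n p = j \<and> length (fst p) < N}"
          using length_less_len_bound[of _ d] N by (force simp: S_def)
      qed (auto simp: S_def)
      also have "\<dots> = fps_nth (dec s T $ c) m"
        using c by (simp add: T_nth dec_def[OF s_pos] d_def)
      finally show ?thesis .
    qed
    then show "eventually (\<lambda>N. fps_nth (\<Sum>p\<in>{p. is_path n p \<and> path_target n p = j \<and> length (fst p) < N}.
          fps_const (f p) * (L_path s I p (v (snd p)) $ c)) m = fps_nth (dec s T $ c) m) sequentially"
      unfolding eventually_sequentially by blast
  qed
  then have "L_act n s I f v j = vec s (\<lambda>c. dec s T $ c)"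
    using j by (auto simp: L_act_def intro!: eq_vecI)
  then show ?thesis unfolding T_def by (auto simp: dec_def[OF s_pos] intro!: eq_vecI)
qed

end

section \<open>The defining ideal is the kernel of the symbol\<close>

lemma cpa_minus:
  assumes "f \<in> carrier (completed_path_algebra n)"
  shows "\<ominus>\<^bsub>completed_path_algebra n\<^esub> f = (\<lambda>p. - f p)"
proof -
  interpret ring "completed_path_algebra n" by (rule ring_completed_path_algebra)
  show ?thesis
    by (rule minus_equality) (use assms in \<open>auto simp: carrier_cpa add_cpa zero_cpa\<close>)
qed

lemma cpa_ideal_diff:
  assumes J: "ideal J (completed_path_algebra n)" and "f \<in> J" "g \<in> J"
  shows "(\<lambda>p. f p - g p) \<in> J"
proof -
  interpret ideal J "completed_path_algebra n" by fact
  have "f \<oplus>\<^bsub>completed_path_algebra n\<^esub> (\<ominus>\<^bsub>completed_path_algebra n\<^esub> g) \<in> J"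
    using assms by (simp add: a_inv_closed)
  then show ?thesis
    using assms(3) Icarr by (simp add: cpa_minus add_cpa)
qed

context k_subset_family
begin

lemma ring_A: "ring A"
  by (rule ring_completed_path_algebra)

definition symbol_kernel :: "(path \<Rightarrow> complex) set" where
  "symbol_kernel = {f \<in> carrier A. \<forall>j\<in>{1..n}. \<forall>i\<in>{1..n}. symbol f j i = 0}"

lemma ideal_symbol_kernel: "ideal symbol_kernel A"
proof (rule idealI[OF ring_A])
  interpret A: ring A by (rule ring_A)
  show "subgroup symbol_kernel (add_monoid A)"
  proof (rule A.add.subgroupI)
    show "symbol_kernel \<noteq> {}"
      using A.zero_closed symbol_zero by (auto simp: symbol_kernel_def)
    fix f assume f: "f \<in> symbol_kernel"
    then have "symbol (\<lambda>p. \<zero>\<^bsub>A\<^esub> p - f p) j i = symbol \<zero>\<^bsub>A\<^esub> j i - symbol f j i" for i j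
      by (simp only: symbol_diff)
    then show "\<ominus>\<^bsub>A\<^esub> f \<in> symbol_kernel"
      using f A.a_inv_closed by (simp add: symbol_kernel_def cpa_minus symbol_zero[unfolded zero_cpa] zero_cpa)
  qed (auto simp: symbol_kernel_def symbol_add)
  fix f g assume f: "f \<in> symbol_kernel" and g: "g \<in> carrier A"
  show "g \<otimes>\<^bsub>A\<^esub> f \<in> symbol_kernel" "f \<otimes>\<^bsub>A\<^esub> g \<in> symbol_kernel"
    using f g by (auto simp: symbol_kernel_def symbol_mult)
qed

text \<open>A path is encoded by its starting vertex and by the list of the directions of its arrows,
  where \<open>True\<close> stands for \<open>x\<close> and \<open>False\<close> for \<open>y\<close>; as in a path, the last entry is the first step.\<close>

definition shift :: "bool list \<Rightarrow> int" where
  "shift bs = (\<Sum>b\<leftarrow>bs. if b then 1 else -1)"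

lemma shift_simps [simp]:
  "shift [] = 0" "shift (b # bs) = (if b then 1 else -1) + shift bs"
  "shift (bs @ cs) = shift bs + shift cs" "shift (replicate m b) = (if b then int m else - int m)"
  by (auto simp: shift_def sum_list_replicate)

text \<open>The index of an arrow is the target of an \<open>X\<close> but the source of a
  \<open>Y\<close>; this is why only the first case adds 1 to the current vertex.\<close>

primrec word :: "bool list \<Rightarrow> nat \<Rightarrow> arrow list" where
  "word [] i = []"
| "word (b # bs) i =
    (if b then X (vtx n (int i + shift bs + 1)) else Y (vtx n (int i + shift bs))) # word bs i"

lemma vtx_vtx_add: "vtx n (int (vtx n m) + c) = vtx n (m + c)"
  using vtx_mod[OF n_pos, of m] by (intro vtx_cong) (metis mod_add_left_eq)

lemma vtx_vtx_diff: "vtx n (int (vtx n m) - c) = vtx n (m - c)"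
  using vtx_vtx_add[of m "- c"] by simp

lemma vtx_in: "vtx n m \<in> {1..n}"
  by (rule vtx_range[OF n_pos])

lemma path_word:
  "i \<in> {1..n} \<Longrightarrow> is_path n (word bs i, i) \<and> path_target n (word bs i, i) = vtx n (int i + shift bs)"
proof (induction bs)
  case Nil
  then show ?case by (simp add: vtx_of_nat)
next
  case (Cons b bs)
  then show ?case
    using vtx_in by (auto simp: arrows_def vtx_vtx_diff algebra_simps simp del: atLeastAtMost_iff)
qed

text \<open>Every vertex is the source of exactly one \<open>X\<close> and one \<open>Y\<close>, so
  directions and starting vertex determine a path.\<close>

lemma ex_word: "is_path n (as, i) \<Longrightarrow> \<exists>bs. as = word bs i"
proof (induction as)
  case Nil
  then show ?case by (intro exI[of _ "[]"]) simp
next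
  case (Cons a as)
  then obtain bs where bs: "as = word bs i" by auto
  have i: "i \<in> {1..n}" using Cons.prems is_path_source by blast
  have src: "arrow_source n a = vtx n (int i + shift bs)"
    using Cons.prems path_word[OF i, of bs] by (simp add: bs)
  show ?case
  proof (cases a)
    case (X j)
    then have "j \<in> {1..n}" using Cons.prems by (auto simp: arrows_def)
    then have "j = vtx n (int (vtx n (int j - 1)) + 1)"
      unfolding vtx_vtx_add by (simp add: vtx_of_nat)
    also have "\<dots> = vtx n (int i + shift bs + 1)"
      using src X by (simp add: vtx_vtx_add)
    finally show ?thesis using X bs by (intro exI[of _ "True # bs"]) simp
  next
    case (Y j)
    then show ?thesis using src bs by (intro exI[of _ "False # bs"]) simp
  qed
qed

lemma word_append: "word (us @ ws) i = word us (vtx n (int i + shift ws)) @ word ws i"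
proof (induction us)
  case (Cons u us)
  show ?case
    using Cons vtx_vtx_add[of "int i + shift ws" "shift us + 1"] vtx_vtx_add[of "int i + shift ws" "shift us"]
    by (simp add: algebra_simps)
qed simp

lemma path_deg_word:
  "path_deg (word bs i, i) = (\<Sum>b\<leftarrow>bs. if b then n - k else k)"
  by (induction bs) (auto simp: path_deg_def)

lemma x_power_word: "x_power n m i = (word (replicate m True) i, i)"
  by (induction m) (auto simp: x_power_def)

lemma y_power_word: "y_power n m i = (word (replicate m False) i, i)"
  by (induction m) (auto simp: y_power_def)

lemma xy_word:
  "i \<in> {1..n} \<Longrightarrow> word [True, False] i = [X i, Y i]"
  "word [False, True] i = [Y (vtx n (int i + 1)), X (vtx n (int i + 1))]"
  by (simp_all add: vtx_of_nat)

definition word_relation :: "bool list \<Rightarrow> bool list \<Rightarrow> nat \<Rightarrow> path \<Rightarrow> complex" where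
  "word_relation bs cs i = (\<lambda>q. single (word bs i, i) q - single (word cs i, i) q)"

lemma B_relations_word:
  "B_relations k n = (\<Union>i\<in>{1..n}. {word_relation [True, False] [False, True] i,
     word_relation (replicate k True) (replicate (n - k) False) i})"
  unfolding B_relations_def word_relation_def x_power_word y_power_word
  by (intro SUP_cong refl) (simp only: xy_word)

lemma word_relation_carrier: "i \<in> {1..n} \<Longrightarrow> word_relation bs cs i \<in> carrier A"
  using path_word[of i bs] path_word[of i cs] by (auto simp: word_relation_def carrier_cpa single_def)

text \<open>Congruent shifts give equal targets; then \<open>wt_deg\<close> turns equal degrees into
  equal weights, and the two symbols cancel.\<close>

lemma word_relation_kernel:
  assumes i: "i \<in> {1..n}" and shift: "shift bs mod int n = shift cs mod int n"
    and deg: "path_deg (word bs i, i) = path_deg (word cs i, i)"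
  shows "word_relation bs cs i \<in> symbol_kernel"
proof -
  have tgt: "path_target n (word bs i, i) = path_target n (word cs i, i)"
    using path_word[OF i] vtx_cong[OF mod_add_cong[OF refl shift]] by metis
  then have "int n * int (path_wt (word bs i, i)) = int n * int (path_wt (word cs i, i))"
    using wt_deg[of "(word bs i, i)"] wt_deg[of "(word cs i, i)"] path_word[OF i] deg by simp
  then have "path_wt (word bs i, i) = path_wt (word cs i, i)"
    using n_pos by simp
  then show ?thesis
    using word_relation_carrier[OF i, of bs cs] path_word[OF i] tgt
    unfolding symbol_kernel_def word_relation_def mem_Collect_eq symbol_diff
    by (auto simp: symbol_single)
qed

section \<open>The ideal generated by the relations, before closure, and rewriting of words modulo
  it\<close>

abbreviation J :: "(path \<Rightarrow> complex) set" where "J \<equiv> genideal A (B_relations k n)"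

lemma relations_carrier: "B_relations k n \<subseteq> carrier A"
  unfolding B_relations_word using word_relation_carrier by auto

lemma ideal_J: "ideal J A"
  using ring.genideal_ideal[OF ring_A relations_carrier] .

lemma shift_power_cong: "shift (replicate k True) mod int n = shift (replicate (n - k) False) mod int n"
  using k_less by (simp add: of_nat_diff mod_eq_dvd_iff)

text \<open>Both kinds of generators compare words of equal degree whose shifts agree modulo
  \<open>n\<close>: in the second kind the shifts \<open>k\<close> and \<open>- (n - k)\<close>
  differ by \<open>n\<close>.\<close>

lemma J_subset_kernel: "J \<subseteq> symbol_kernel"
proof (rule ring.genideal_minimal[OF ring_A ideal_symbol_kernel])
  have "word_relation [True, False] [False, True] i \<in> symbol_kernel" if "i \<in> {1..n}" for i
    using that by (intro word_relation_kernel) (simp_all add: path_deg_word del: word.simps)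
  moreover have "word_relation (replicate k True) (replicate (n - k) False) i \<in> symbol_kernel"
    if "i \<in> {1..n}" for i
    using that shift_power_cong
    by (intro word_relation_kernel) (simp_all add: path_deg_word sum_list_replicate)
  ultimately show "B_relations k n \<subseteq> symbol_kernel"
    unfolding B_relations_word by blast
qed

text \<open>Congruence is required from all starting vertices at once, so that it survives in any
  context. The condition on shifts says that both words lead to the same vertex.\<close>

definition word_equiv :: "bool list \<Rightarrow> bool list \<Rightarrow> bool" where
  "word_equiv bs cs \<longleftrightarrow> shift bs mod int n = shift cs mod int n \<and>
     (\<forall>i\<in>{1..n}. word_relation bs cs i \<in> J)"

lemma word_equiv_refl: "word_equiv bs bs"
  using additive_subgroup.zero_closed[OF ideal.axioms(1)[OF ideal_J]]
  by (simp add: word_equiv_def word_relation_def zero_cpa)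

text \<open>The Euclidean form follows from a single difference in \<open>J\<close>; with
  reflexivity it yields symmetry and transitivity.\<close>

lemma word_equiv_right:
  assumes "word_equiv bs cs" "word_equiv ds cs"
  shows "word_equiv bs ds"
  unfolding word_equiv_def
proof (intro conjI ballI)
  fix i assume "i \<in> {1..n}"
  then have "(\<lambda>q. word_relation bs cs i q - word_relation ds cs i q) \<in> J"
    using assms by (intro cpa_ideal_diff[OF ideal_J]) (auto simp: word_equiv_def)
  then show "word_relation bs ds i \<in> J" by (simp add: word_relation_def)
qed (use assms in \<open>auto simp: word_equiv_def\<close>)

lemma word_equiv_sym: "word_equiv bs cs \<Longrightarrow> word_equiv cs bs"
  using word_equiv_right word_equiv_refl by blast

lemma word_equiv_trans: "word_equiv bs cs \<Longrightarrow> word_equiv cs ds \<Longrightarrow> word_equiv bs ds"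
  using word_equiv_right word_equiv_sym by blast

text \<open>The relation between the longer words is the product of the path of \<open>us\<close>,
  the given relation and the path of \<open>ws\<close>. The left factor starts at the same vertex
  \<open>t\<close> for both words because their shifts are congruent.\<close>

lemma word_equiv_context:
  assumes "word_equiv bs cs"
  shows "word_equiv (us @ bs @ ws) (us @ cs @ ws)"
  unfolding word_equiv_def
proof (intro conjI ballI)
  show "shift (us @ bs @ ws) mod int n = shift (us @ cs @ ws) mod int n"
    using assms by (auto simp: word_equiv_def intro!: mod_add_cong)
next
  fix i assume i: "i \<in> {1..n}"
  define i' where "i' = vtx n (int i + shift ws)"
  define t where "t = vtx n (int i' + shift bs)"
  have i': "i' \<in> {1..n}" and t: "t \<in> {1..n}" unfolding i'_def t_def by (rule vtx_in)+
  have t': "t = vtx n (int i' + shift cs)"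
    using assms unfolding t_def word_equiv_def by (auto intro!: vtx_cong mod_add_cong)
  have split: "single (word (us @ ds @ ws) i, i) =
      single (word us t, t) \<otimes>\<^bsub>A\<^esub> (single (word ds i', i') \<otimes>\<^bsub>A\<^esub> single (word ws i, i))"
    if "t = vtx n (int i' + shift ds)" for ds
  proof -
    have "word (us @ ds @ ws) i = word us t @ word ds i' @ word ws i"
      unfolding word_append that i'_def vtx_vtx_add by (simp add: ac_simps)
    then show ?thesis
      using path_word[OF i] path_word[OF i'] that
      by (simp add: single_mult_single i'_def)
  qed
  have "word_relation (us @ bs @ ws) (us @ cs @ ws) i =
      single (word us t, t) \<otimes>\<^bsub>A\<^esub> (word_relation bs cs i' \<otimes>\<^bsub>A\<^esub> single (word ws i, i))"
    using split[OF t_def] split[OF t']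
    by (simp add: word_relation_def cpa_mult_diff_left cpa_mult_diff_right)
  also have "\<dots> \<in> J"
    using assms i i' t path_word
    by (intro ideal.I_l_closed[OF ideal_J] ideal.I_r_closed[OF ideal_J] single_carrier)
      (auto simp: word_equiv_def)
  finally show "word_relation (us @ bs @ ws) (us @ cs @ ws) i \<in> J" .
qed

lemma word_equiv_append_left: "word_equiv bs cs \<Longrightarrow> word_equiv (us @ bs) (us @ cs)"
  using word_equiv_context[of bs cs us "[]"] by simp

lemma word_equiv_append_right: "word_equiv bs cs \<Longrightarrow> word_equiv (bs @ ws) (cs @ ws)"
  using word_equiv_context[of bs cs "[]" ws] by simp

lemma relations_subset_J: "B_relations k n \<subseteq> J"
  by (rule ring.genideal_self[OF ring_A relations_carrier])

lemma word_equiv_swap: "word_equiv [True, False] [False, True]"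
  using relations_subset_J unfolding B_relations_word word_equiv_def by auto

lemma word_equiv_power: "word_equiv (replicate k True) (replicate (n - k) False)"
  using relations_subset_J shift_power_cong unfolding B_relations_word word_equiv_def by blast

lemma word_equiv_move: "word_equiv (False # replicate a True) (replicate a True @ [False])"
proof (induction a)
  case (Suc a)
  have "word_equiv ([False, True] @ replicate a True) ([True, False] @ replicate a True)"
    by (rule word_equiv_append_right[OF word_equiv_sym[OF word_equiv_swap]])
  moreover have "word_equiv ([True] @ False # replicate a True) ([True] @ replicate a True @ [False])"
    using Suc by (rule word_equiv_append_left)
  ultimately show ?case using word_equiv_trans by simp
qed (simp add: word_equiv_refl)

text \<open>Each \<open>y\<close> is moved to the right past all \<open>x\<close>; \<open>a\<close>
  and \<open>b\<close> count the letters, which the swaps preserve, so shift and degree can be read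
  off.\<close>

lemma word_equiv_normal:
  "\<exists>a b. word_equiv bs (replicate a True @ replicate b False) \<and>
     shift bs = int a - int b \<and> (\<Sum>b\<leftarrow>bs. if b then n - k else k) = a * (n - k) + b * k"
proof (induction bs)
  case Nil
  have "word_equiv [] (replicate 0 True @ replicate 0 False)" by (simp add: word_equiv_refl)
  then show ?case by (intro exI[of _ 0]) simp
next
  case (Cons c bs)
  then obtain a b where ab: "word_equiv bs (replicate a True @ replicate b False)"
    "shift bs = int a - int b" "(\<Sum>b\<leftarrow>bs. if b then n - k else k) = a * (n - k) + b * k"
    by blast
  from word_equiv_append_left[OF ab(1), of "[c]"]
  have eq: "word_equiv (c # bs) (c # replicate a True @ replicate b False)" by simp
  show ?case
  proof (cases c)
    case True
    then show ?thesis
      using ab eq by (intro exI[of _ "Suc a"] exI[of _ b]) simp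
  next
    case False
    have "word_equiv (c # bs) (replicate a True @ replicate (Suc b) False)"
      using word_equiv_trans[OF eq] False
        word_equiv_append_right[OF word_equiv_move[of a], of "replicate b False"] by simp
    then show ?thesis
      using ab False by (intro exI[of _ a] exI[of _ "Suc b"]) simp
  qed
qed

text \<open>The relation \<open>x^k = y^(n-k)\<close> is applied \<open>w\<close> times at the
  border between the \<open>x\<close> and the \<open>y\<close>.\<close>

lemma word_equiv_exchange:
  "word_equiv (replicate (a + k * w) True @ replicate b False)
     (replicate a True @ replicate (b + (n - k) * w) False)"
proof (induction w arbitrary: b)
  case (Suc w)
  have "word_equiv (replicate (a + k * w) True @ replicate k True @ replicate b False)
      (replicate (a + k * w) True @ replicate (n - k) False @ replicate b False)"
    by (rule word_equiv_context[OF word_equiv_power])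
  moreover have "replicate (a + k * Suc w) True = replicate (a + k * w) True @ replicate k True"
    by (simp add: ac_simps flip: replicate_add)
  ultimately have "word_equiv (replicate (a + k * Suc w) True @ replicate b False)
      (replicate (a + k * w) True @ replicate (n - k + b) False)"
    by (simp add: replicate_add)
  from word_equiv_trans[OF this Suc] show ?case by (simp add: ac_simps)
qed (simp add: word_equiv_refl)

text \<open>Equal endpoints and weights give equal degrees by \<open>wt_deg\<close>, and shifts
  congruent modulo \<open>n\<close>. These two conditions force the normal forms of the two words to
  differ by a multiple of the trade of \<open>x^k\<close> for \<open>y^(n-k)\<close>.\<close>

lemma parallel_paths_equiv:
  assumes p: "is_path n p" and q: "is_path n q" and tgt: "path_target n p = path_target n q"
    and src: "snd p = snd q" and wt: "path_wt p = path_wt q"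
  shows "(\<lambda>x. single p x - single q x) \<in> J"
proof -
  define i where "i = snd p"
  have i: "i \<in> {1..n}" using p is_path_source[of n "fst p" i] by (simp add: i_def)
  obtain bs cs where bs: "p = (word bs i, i)" and cs: "q = (word cs i, i)"
    using ex_word[of "fst p" i] ex_word[of "fst q" i] p q src unfolding i_def
    by (metis prod.collapse)
  obtain a b where ab: "word_equiv bs (replicate a True @ replicate b False)"
    "shift bs = int a - int b" "(\<Sum>b\<leftarrow>bs. if b then n - k else k) = a * (n - k) + b * k"
    using word_equiv_normal by blast
  obtain a' b' where ab': "word_equiv cs (replicate a' True @ replicate b' False)"
    "shift cs = int a' - int b'" "(\<Sum>b\<leftarrow>cs. if b then n - k else k) = a' * (n - k) + b' * k"
    using word_equiv_normal by blast
  have "int s * int (path_deg p) = int s * int (path_deg q)"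
    using wt_deg[OF p] wt_deg[OF q] unfolding tgt src wt by linarith
  then have "path_deg p = path_deg q" using s_pos by simp
  then have "a * (n - k) + b * k = a' * (n - k) + b' * k"
    unfolding bs cs path_deg_word ab(3) ab'(3) .
  then have "int (a * (n - k) + b * k) = int (a' * (n - k) + b' * k)" by simp
  then have deg: "int a * (int n - int k) + int b * int k = int a' * (int n - int k) + int b' * int k"
    using k_less by (simp add: of_nat_diff)
  have "(int i + shift bs) mod int n = (int i + shift cs) mod int n"
    using tgt path_word[OF i] unfolding bs cs by (simp add: vtx_eq_iff[OF n_pos])
  then have "int n dvd (int a - int b) - (int a' - int b')"
    using ab(2) ab'(2) by (simp add: mod_eq_dvd_iff)
  then obtain w where w: "(int a - int b) - (int a' - int b') = int n * w" by blast
  \<comment> \<open>The degree of a normal form is \<open>n * a - k * (a - b)\<close>, so equal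
    degrees relate the difference of the exponents of \<open>x\<close> to the difference of the
    shifts, which is \<open>n * w\<close>.\<close>
  have "int n * (int a - int a') = int k * ((int a - int b) - (int a' - int b'))"
    using deg by (simp add: algebra_simps)
  then have "int n * (int a - int a') = int n * (int k * w)"
    unfolding w by simp
  then have aw: "int a - int a' = int k * w" using n_pos by simp
  then have bw: "int b' - int b = (int n - int k) * w" using w by (simp add: algebra_simps)
  \<comment> \<open>The sign of \<open>w\<close> decides which of the two normal forms has the
    surplus of \<open>x\<close>.\<close>
  have "word_equiv bs cs"
  proof (cases "0 \<le> w")
    case True
    define v where "v = nat w"
    have "int a = int (a' + k * v)" "int b' = int (b + (n - k) * v)"
      using aw bw True k_less by (simp_all add: v_def of_nat_diff)
    then have "a = a' + k * v" "b' = b + (n - k) * v" by (simp_all only: of_nat_eq_iff)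
    then have "word_equiv (replicate a True @ replicate b False) (replicate a' True @ replicate b' False)"
      using word_equiv_exchange by simp
    then show ?thesis
      using ab(1) ab'(1) word_equiv_trans word_equiv_sym by meson
  next
    case False
    define v where "v = nat (- w)"
    have "int a' = int (a + k * v)" "int b = int (b' + (n - k) * v)"
      using aw bw False k_less by (simp_all add: v_def of_nat_diff)
    then have "a' = a + k * v" "b = b' + (n - k) * v" by (simp_all only: of_nat_eq_iff)
    then have "word_equiv (replicate a' True @ replicate b' False) (replicate a True @ replicate b False)"
      using word_equiv_exchange by simp
    then show ?thesis
      using ab(1) ab'(1) word_equiv_trans word_equiv_sym by meson
  qed
  then show ?thesis using i unfolding word_equiv_def word_relation_def bs cs by blast
qed

section \<open>The closed ideal and the kernel of the symbol coincide\<close>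

lemma wt_le_length: "path_wt p \<le> length (fst p) * s"
proof -
  have le: "wt a \<le> s" for a using r_num_le by (cases a) auto
  have "(\<Sum>a\<leftarrow>as. wt a) \<le> length as * s" for as
  proof (induction as)
    case (Cons a as)
    then show ?case using le[of a] by (simp add: add_mono)
  qed simp
  then show ?thesis by (simp add: path_wt_def)
qed

text \<open>Each path is replaced by a representative of its class of paths with the same endpoints
  and weight. The differences lie in \<open>J\<close>, and what accumulates on a representative is
  the sum of \<open>f\<close> over its class, a coefficient of the symbol and hence 0.\<close>

lemma kernel_subset_closure: "symbol_kernel \<subseteq> B_ideal k n"
proof
  fix f assume f: "f \<in> symbol_kernel"
  \<comment> \<open>The choice depends only on the endpoints and the weight, so paths of one class
    share their representative.\<close>
  define rep where "rep p = (SOME q. q \<in> paths (path_target n p) (snd p) (path_wt p))" for p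
  have rep: "rep p \<in> paths (path_target n p) (snd p) (path_wt p)" if "is_path n p" for p
    unfolding rep_def by (rule someI[of _ p]) (simp add: paths_def that)
  have "\<exists>g\<in>J. \<forall>q. length (fst q) < N \<longrightarrow> f q = g q" for N
  proof -
    \<comment> \<open>A path shorter than \<open>N\<close> has weight at most \<open>N * s\<close>,
      so \<open>T\<close> contains its entire class, including members that are longer than
      \<open>N\<close>.\<close>
    define N' where "N' = max N (len_bound (N * s))"
    define T where "T = {p. is_path n p \<and> length (fst p) < N'}"
    define h where "h q = (\<Sum>p\<in>T. f p * (single p q - single (rep p) q))" for q
    have finT: "finite T" unfolding T_def by (rule finite_paths)
    have "h \<in> J" unfolding h_def
    proof (rule cpa_ideal_lincomb[OF ideal_J finT])
      fix p assume "p \<in> T"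
      then have p: "is_path n p" by (simp add: T_def)
      then show "(\<lambda>q. single p q - single (rep p) q) \<in> J"
        using rep[OF p] by (intro parallel_paths_equiv) (auto simp: paths_def)
    qed
    moreover have "f q = h q" if len: "length (fst q) < N" for q
    proof -
      have "(\<Sum>p\<in>T. f p * single p q) = (\<Sum>p\<in>T. if p = q then f q else 0)"
        by (intro sum.cong) (auto simp: single_def)
      also have "\<dots> = f q"
        using f len finT by (cases q) (auto simp: T_def N'_def symbol_kernel_def carrier_cpa)
      finally have 1: "(\<Sum>p\<in>T. f p * single p q) = f q" .
      have "(\<Sum>p\<in>T. f p * single (rep p) q) = (\<Sum>p\<in>{p\<in>T. rep p = q}. f p)"
        using finT by (intro sum.mono_neutral_cong_right) (auto simp: single_def)
      also have "\<dots> = 0"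
      proof (cases "\<exists>p\<in>T. rep p = q")
        case True
        then obtain p0 where p0: "is_path n p0" "rep p0 = q" by (auto simp: T_def)
        from rep[OF p0(1)] p0(2) have q: "is_path n q" "path_target n q = path_target n p0"
          "snd q = snd p0" "path_wt q = path_wt p0" by (auto simp: paths_def)
        have "{p\<in>T. rep p = q} = paths (path_target n q) (snd q) (path_wt q)"
        proof (intro equalityI subsetI)
          fix p assume "p \<in> {p\<in>T. rep p = q}"
          then show "p \<in> paths (path_target n q) (snd q) (path_wt q)"
            using rep[of p] by (auto simp: T_def paths_def)
        next
          fix p assume "p \<in> paths (path_target n q) (snd q) (path_wt q)"
          then have p: "is_path n p" "path_target n p = path_target n q" "snd p = snd q"
            "path_wt p = path_wt q" by (auto simp: paths_def)
          then have "rep p = rep p0" unfolding rep_def q by simp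
          moreover have "length (fst q) * s \<le> N * s"
            using len by (intro mult_le_mono1) simp
          then have "path_wt p \<le> N * s"
            using wt_le_length[of q] p(4) by linarith
          then have "length (fst p) < N'"
            using length_less_len_bound[OF p(1), of "N * s"] by (simp add: N'_def)
          ultimately show "p \<in> {p\<in>T. rep p = q}" using p0(2) p(1) by (simp add: T_def)
        qed
        then have "(\<Sum>p\<in>{p\<in>T. rep p = q}. f p) =
            fps_nth (symbol f (path_target n q) (snd q)) (path_wt q)"
          by (simp add: symbol_nth)
        then show ?thesis
          using f q(1) is_path_target[OF q(1)] is_path_source[of n "fst q" "snd q"]
          by (simp add: symbol_kernel_def)
      next
        case False
        then have "{p\<in>T. rep p = q} = {}" by blast
        then show ?thesis by (simp only: sum.empty)
      qed
      finally show ?thesis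
        using 1 by (simp add: h_def right_diff_distrib sum_subtractf)
    qed
    ultimately show ?thesis by blast
  qed
  then show "f \<in> B_ideal k n"
    using f by (auto simp: B_ideal_def arrow_adic_closure_def symbol_kernel_def)
qed

text \<open>The kernel is closed, since each coefficient of the symbol involves only paths of
  bounded length.\<close>

lemma closure_subset_kernel: "B_ideal k n \<subseteq> symbol_kernel"
proof
  fix f assume "f \<in> B_ideal k n"
  then have carr: "f \<in> carrier A" and approx: "\<And>N. \<exists>g\<in>J. \<forall>p. length (fst p) < N \<longrightarrow> f p = g p"
    by (auto simp: B_ideal_def arrow_adic_closure_def)
  have "symbol f j i = 0" if ij: "j \<in> {1..n}" "i \<in> {1..n}" for i j
  proof (rule fps_ext)
    fix d
    obtain g where g: "g \<in> J" "\<And>p. length (fst p) < len_bound d \<Longrightarrow> f p = g p"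
      using approx[of "len_bound d"] by blast
    have "fps_nth (symbol f j i) d = fps_nth (symbol g j i) d"
      unfolding symbol_nth
      by (intro sum.cong refl g(2) length_less_len_bound) (auto simp: paths_def)
    then show "fps_nth (symbol f j i) d = fps_nth 0 d"
      using g(1) J_subset_kernel ij by (auto simp: symbol_kernel_def)
  qed
  then show "f \<in> symbol_kernel" using carr by (simp add: symbol_kernel_def)
qed

lemma B_ideal_eq: "B_ideal k n = symbol_kernel"
  using kernel_subset_closure closure_subset_kernel by blast

end

section \<open>The module structure\<close>

lemma ring_center_simps [simp]:
  "carrier (ring_center R) = {z \<in> carrier R. \<forall>a\<in>carrier R. z \<otimes>\<^bsub>R\<^esub> a = a \<otimes>\<^bsub>R\<^esub> z}"
  "mult (ring_center R) = mult R" "one (ring_center R) = one R"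
  "zero (ring_center R) = zero R" "add (ring_center R) = add R"
  by (simp_all add: ring_center_def)

lemma (in ring) cring_ring_center: "cring (ring_center R)"
proof -
  define Z where "Z = {z \<in> carrier R. \<forall>a\<in>carrier R. z \<otimes> a = a \<otimes> z}"
  have carr: "z \<in> carrier R" and comm: "a \<in> carrier R \<Longrightarrow> z \<otimes> a = a \<otimes> z" if "z \<in> Z" for z a
    using that unfolding Z_def by blast+
  have ZI: "z \<in> Z" if "z \<in> carrier R" "\<And>a. a \<in> carrier R \<Longrightarrow> z \<otimes> a = a \<otimes> z" for z
    using that unfolding Z_def by blast
  have "subring Z R"
  proof (rule subringI)
    show "Z \<subseteq> carrier R" using carr by blast
    show "\<one> \<in> Z" by (rule ZI) simp_all
    fix z assume z: "z \<in> Z"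
    show "\<ominus> z \<in> Z"
      by (rule ZI) (use carr[OF z] comm[OF z] in \<open>simp_all only: l_minus r_minus a_inv_closed\<close>)
    fix w assume w: "w \<in> Z"
    show "z \<oplus> w \<in> Z"
      by (rule ZI)
        (use carr[OF z] carr[OF w] comm[OF z] comm[OF w] in \<open>simp_all only: l_distr r_distr a_closed\<close>)
    show "z \<otimes> w \<in> Z"
    proof (rule ZI)
      fix a assume a: "a \<in> carrier R"
      have "z \<otimes> w \<otimes> a = z \<otimes> (w \<otimes> a)" using carr[OF z] carr[OF w] a by (rule m_assoc)
      also have "w \<otimes> a = a \<otimes> w" using comm[OF w a] .
      also have "z \<otimes> (a \<otimes> w) = z \<otimes> a \<otimes> w" using carr[OF z] a carr[OF w] by (rule m_assoc[symmetric])
      also have "z \<otimes> a = a \<otimes> z" using comm[OF z a] .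
      also have "a \<otimes> z \<otimes> w = a \<otimes> (z \<otimes> w)" using a carr[OF z] carr[OF w] by (rule m_assoc)
      finally show "z \<otimes> w \<otimes> a = a \<otimes> (z \<otimes> w)" .
    qed (use carr[OF z] carr[OF w] in simp)
  qed
  moreover have "z \<otimes> w = w \<otimes> z" if "z \<in> Z" "w \<in> Z" for z w
    using comm[OF that(1) carr[OF that(2)]] .
  ultimately have "subcring Z R"
    by (intro subcring.intro subcring_axioms.intro)
  then have "cring (R\<lparr>carrier := Z\<rparr>)"
    using subcring_iff[of Z] carr by blast
  then show ?thesis
    by (simp only: ring_center_def Z_def)
qed

lemma left_module_center_module:
  assumes "left_module R M"
  shows "module (ring_center R) M"
proof -
  interpret left_module R M by fact
  have Z: "a \<in> carrier R" if "a \<in> carrier (ring_center R)" for a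
    using that unfolding ring_center_simps by blast
  show ?thesis
  proof (intro module.intro module_axioms.intro)
    show "cring (ring_center R)" by (rule R.cring_ring_center)
    show "abelian_group M" by (rule M.abelian_group_axioms)
  qed (unfold ring_center_simps(2-),
      (rule smult_closed smult_l_distr smult_r_distr smult_assoc smult_one; (intro Z)?; assumption)+)
qed

text \<open>Central coefficients are coefficients in \<open>R\<close>; the sum over the support
  extends to all of \<open>S\<close> by zero terms.\<close>

lemma finitely_generated_of_center_basis:
  assumes M: "left_module R M" and S: "finite S" and basis: "is_basis (ring_center R) M S"
  shows "finitely_generated R M"
  unfolding finitely_generated_def
proof (intro exI conjI ballI)
  interpret left_module R M by fact
  interpret Z: module "ring_center R" M by (rule left_module_center_module[OF M])
  show "S \<subseteq> carrier M" using basis by (simp add: is_basis_def)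
  fix v assume "v \<in> carrier M"
  then obtain c where cZ: "\<And>x. x \<in> S \<Longrightarrow> c x \<in> carrier (ring_center R)"
    and c:
      "\<And>x. x \<notin> S \<Longrightarrow> c x = \<zero>\<^bsub>R\<^esub>" "v = (\<Oplus>\<^bsub>M\<^esub>x\<in>{x. c x \<noteq> \<zero>\<^bsub>R\<^esub>}. c x \<odot>\<^bsub>M\<^esub> x)"
    using basis unfolding is_basis_def ring_center_simps(4) by meson
  have cR: "c x \<in> carrier R" if "x \<in> S" for x
    using cZ[OF that] unfolding ring_center_simps by blast
  have "(\<Oplus>\<^bsub>M\<^esub>x\<in>{x. c x \<noteq> \<zero>\<^bsub>R\<^esub>}. c x \<odot>\<^bsub>M\<^esub> x) = (\<Oplus>\<^bsub>M\<^esub>x\<in>S. c x \<odot>\<^bsub>M\<^esub> x)"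
  proof (rule M.add.finprod_mono_neutral_cong_left[OF S])
    show "{x. c x \<noteq> \<zero>\<^bsub>R\<^esub>} \<subseteq> S" using c(1) by blast
    show "c x \<odot>\<^bsub>M\<^esub> x = \<zero>\<^bsub>M\<^esub>" if "x \<in> S - {x. c x \<noteq> \<zero>\<^bsub>R\<^esub>}" for x
      using that Z.smult_l_null[of x] \<open>S \<subseteq> carrier M\<close> by auto
  qed (use cR \<open>S \<subseteq> carrier M\<close> in \<open>auto intro!: smult_closed\<close>)
  then show "\<exists>c\<in>S \<rightarrow> carrier R. v = (\<Oplus>\<^bsub>M\<^esub>x\<in>S. c x \<odot>\<^bsub>M\<^esub> x)"
    using c(2) cR by (intro bexI[of _ c]) auto
qed (rule S)

context k_subset_family
begin

section \<open>The quotient algebra and its action in terms of symbols\<close>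

abbreviation B :: "(path \<Rightarrow> complex) set ring" where "B \<equiv> B_algebra k n"

abbreviation L :: "((path \<Rightarrow> complex) set, nat \<Rightarrow> complex fps vec) module" where
  "L \<equiv> L_module n s I"

definition coset :: "(path \<Rightarrow> complex) \<Rightarrow> (path \<Rightarrow> complex) set" where
  "coset f = B_ideal k n +>\<^bsub>A\<^esub> f"

lemma ideal_B_ideal: "ideal (B_ideal k n) A"
  by (simp add: B_ideal_eq ideal_symbol_kernel)

lemma ring_B: "ring B"
  unfolding B_algebra_def by (rule ideal.quotient_is_ring[OF ideal_B_ideal])

lemma coset_eq:
  assumes f: "f \<in> carrier A"
  shows "coset f = {g \<in> carrier A. \<forall>j\<in>{1..n}. \<forall>i\<in>{1..n}. symbol g j i = symbol f j i}"
proof (intro equalityI subsetI)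
  interpret A: ring A by (rule ring_A)
  fix g
  {
    assume "g \<in> coset f"
    then obtain h where "h \<in> symbol_kernel" "g = h \<oplus>\<^bsub>A\<^esub> f"
      by (auto simp: coset_def B_ideal_eq a_r_coset_def')
    then show "g \<in> {g \<in> carrier A. \<forall>j\<in>{1..n}. \<forall>i\<in>{1..n}. symbol g j i = symbol f j i}"
      using f by (auto simp: symbol_kernel_def symbol_add)
  next
    assume g: "g \<in> {g \<in> carrier A. \<forall>j\<in>{1..n}. \<forall>i\<in>{1..n}. symbol g j i = symbol f j i}"
    then have "(\<lambda>p. g p - f p) \<in> symbol_kernel"
      using f by (auto simp: symbol_kernel_def symbol_diff carrier_cpa)
    moreover have "g = (\<lambda>p. g p - f p) \<oplus>\<^bsub>A\<^esub> f"
      by (simp add: add_cpa)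
    ultimately show "g \<in> coset f"
      unfolding coset_def B_ideal_eq a_r_coset_def' by blast
  }
qed

lemma coset_eq_iff:
  assumes "f \<in> carrier A" "g \<in> carrier A"
  shows "coset f = coset g \<longleftrightarrow> (\<forall>j\<in>{1..n}. \<forall>i\<in>{1..n}. symbol f j i = symbol g j i)"
  unfolding coset_eq[OF assms(1)] coset_eq[OF assms(2)] using assms by auto

lemma B_carrier: "carrier B = coset ` carrier A"
  by (auto simp: B_algebra_def FactRing_def A_RCOSETS_def' coset_def)

lemma coset_mult:
  "f \<in> carrier A \<Longrightarrow> g \<in> carrier A \<Longrightarrow> coset f \<otimes>\<^bsub>B\<^esub> coset g = coset (f \<otimes>\<^bsub>A\<^esub> g)"
  by (simp add: B_algebra_def FactRing_def coset_def ideal.rcoset_mult_add[OF ideal_B_ideal])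

lemma coset_add:
  "f \<in> carrier A \<Longrightarrow> g \<in> carrier A \<Longrightarrow> coset f \<oplus>\<^bsub>B\<^esub> coset g = coset (f \<oplus>\<^bsub>A\<^esub> g)"
  by (simp add: B_algebra_def FactRing_def coset_def ideal.a_rcos_sum[OF ideal_B_ideal])

lemma coset_one: "\<one>\<^bsub>B\<^esub> = coset \<one>\<^bsub>A\<^esub>"
  by (simp add: B_algebra_def FactRing_def coset_def)

lemma coset_zero: "\<zero>\<^bsub>B\<^esub> = coset \<zero>\<^bsub>A\<^esub>"
proof -
  interpret A: ring A by (rule ring_A)
  have "coset \<zero>\<^bsub>A\<^esub> = symbol_kernel"
    using A.zero_closed by (simp add: coset_eq symbol_kernel_def symbol_zero)
  then show ?thesis
    by (simp add: B_algebra_def FactRing_def B_ideal_eq)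
qed

lemma L_carrier: "carrier L = (\<Pi>\<^sub>E i\<in>{1..n}. carrier_vec s)"
  and L_zero: "\<zero>\<^bsub>L\<^esub> = (\<lambda>i\<in>{1..n}. 0\<^sub>v s)"
  and L_add: "v \<oplus>\<^bsub>L\<^esub> w = (\<lambda>i\<in>{1..n}. v i + w i)"
  by (simp_all add: L_module_def)

lemma L_index: "v \<in> carrier L \<Longrightarrow> i \<in> {1..n} \<Longrightarrow> v i \<in> carrier_vec s"
  unfolding L_carrier by (rule PiE_mem)

text \<open>All representatives of a coset have the same symbol and so act alike by
  \<open>L_act_eq\<close>. The image under the action is a singleton, and \<open>the_elem\<close>
  returns its element.\<close>

lemma L_smult:
  assumes f: "f \<in> carrier A" and v: "v \<in> carrier L"
  shows "coset f \<odot>\<^bsub>L\<^esub> v = (\<lambda>j\<in>{1..n}. dec s (\<Sum>i\<in>{1..n}. symbol f j i * enc_s (v i)))"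
proof -
  have v': "v \<in> {1..n} \<rightarrow> carrier_vec s" using L_index[OF v] by auto
  have act: "L_act n s I g v = (\<lambda>j\<in>{1..n}. dec s (\<Sum>i\<in>{1..n}. symbol f j i * enc_s (v i)))"
    if "g \<in> coset f" for g
  proof (rule ext)
    fix j
    show "L_act n s I g v j = (\<lambda>j\<in>{1..n}. dec s (\<Sum>i\<in>{1..n}. symbol f j i * enc_s (v i))) j"
    proof (cases "j \<in> {1..n}")
      case True
      then have "(\<Sum>i\<in>{1..n}. symbol g j i * enc_s (v i)) = (\<Sum>i\<in>{1..n}. symbol f j i * enc_s (v i))"
        using that by (intro sum.cong) (auto simp: coset_eq[OF f])
      then show ?thesis using True L_act_eq[OF v' True, of g] by simp
    next
      case False
      then show ?thesis by (simp only: L_act_def restrict_apply if_False)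
    qed
  qed
  have "f \<in> coset f" using f by (simp add: coset_eq)
  then have "(\<lambda>g. L_act n s I g v) ` coset f =
      {(\<lambda>j\<in>{1..n}. dec s (\<Sum>i\<in>{1..n}. symbol f j i * enc_s (v i)))}"
    using act by (auto simp: image_iff intro!: bexI[of _ f])
  then show ?thesis by (simp add: L_module_def)
qed

lemma L_smult_closed:
  "f \<in> carrier A \<Longrightarrow> v \<in> carrier L \<Longrightarrow> coset f \<odot>\<^bsub>L\<^esub> v \<in> carrier L"
  by (simp add: L_smult) (auto simp: L_carrier dec_carrier[OF s_pos])

lemma enc_L_smult:
  "f \<in> carrier A \<Longrightarrow> v \<in> carrier L \<Longrightarrow> j \<in> {1..n} \<Longrightarrow>
    enc_s ((coset f \<odot>\<^bsub>L\<^esub> v) j) = (\<Sum>i\<in>{1..n}. symbol f j i * enc_s (v i))"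
  by (simp add: L_smult enc_dec[OF s_pos])

lemma L_add_closed: "v \<in> carrier L \<Longrightarrow> w \<in> carrier L \<Longrightarrow> v \<oplus>\<^bsub>L\<^esub> w \<in> carrier L"
  using L_index by (auto simp: L_add L_carrier)

lemma enc_L_add:
  "v \<in> carrier L \<Longrightarrow> w \<in> carrier L \<Longrightarrow> i \<in> {1..n} \<Longrightarrow>
    enc_s ((v \<oplus>\<^bsub>L\<^esub> w) i) = enc_s (v i) + enc_s (w i)"
  using L_index by (simp add: L_add enc_add[OF s_pos])

text \<open>Reduces identities in \<open>L\<close> to identities of power series in
  \<open>u\<close>; outside \<open>{1..n}\<close> both families are
  \<open>undefined\<close>.\<close>

lemma L_eqI:
  assumes "v \<in> carrier L" "w \<in> carrier L" and "\<And>i. i \<in> {1..n} \<Longrightarrow> enc_s (v i) = enc_s (w i)"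
  shows "v = w"
  using assms(1,2) unfolding L_carrier
  by (rule PiE_ext) (use assms L_index in \<open>auto intro!: enc_inject[OF s_pos]\<close>)

lemma abelian_group_L: "abelian_group L"
proof (rule abelian_groupI)
  show zero: "\<zero>\<^bsub>L\<^esub> \<in> carrier L" by (auto simp: L_zero L_carrier)
  fix v assume v: "v \<in> carrier L"
  then show "\<zero>\<^bsub>L\<^esub> \<oplus>\<^bsub>L\<^esub> v = v"
    using zero by (intro L_eqI L_add_closed) (simp_all add: enc_L_add, simp add: L_zero enc_zero[OF s_pos])
  show "\<exists>w\<in>carrier L. w \<oplus>\<^bsub>L\<^esub> v = \<zero>\<^bsub>L\<^esub>"
  proof (rule bexI[of _ "\<lambda>i\<in>{1..n}. - v i"])
    have "- v i + v i = 0\<^sub>v s" if "i \<in> {1..n}" for i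
      using L_index[OF v that] by (rule uminus_l_inv_vec)
    then show "(\<lambda>i\<in>{1..n}. - v i) \<oplus>\<^bsub>L\<^esub> v = \<zero>\<^bsub>L\<^esub>"
      by (simp add: L_add L_zero cong: restrict_cong)
  qed (use L_index[OF v] in \<open>auto simp: L_carrier\<close>)
  fix w assume w: "w \<in> carrier L"
  show "v \<oplus>\<^bsub>L\<^esub> w = w \<oplus>\<^bsub>L\<^esub> v"
    using v w by (intro L_eqI L_add_closed) (simp_all add: enc_L_add)
  fix u assume u: "u \<in> carrier L"
  show "v \<oplus>\<^bsub>L\<^esub> w \<oplus>\<^bsub>L\<^esub> u = v \<oplus>\<^bsub>L\<^esub> (w \<oplus>\<^bsub>L\<^esub> u)"
    using v w u by (intro L_eqI L_add_closed) (simp_all add: enc_L_add L_add_closed)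
qed (rule L_add_closed)

text \<open>After encoding, the laws are those of matrices over \<open>\<complex>[[u]]\<close>
  acting on column vectors, with associativity coming from \<open>symbol_mult\<close>.\<close>

lemma left_module_L: "left_module B L"
proof -
  interpret A: ring A by (rule ring_A)
  have "left_module_axioms B L"
  proof (rule left_module_axioms.intro)
    fix a x assume "a \<in> carrier B" and x: "x \<in> carrier L"
    then show "a \<odot>\<^bsub>L\<^esub> x \<in> carrier L"
      by (auto simp: B_carrier L_smult_closed)
  next
    fix a x y assume "a \<in> carrier B" and x: "x \<in> carrier L" and y: "y \<in> carrier L"
    then obtain f where f: "f \<in> carrier A" and a: "a = coset f" by (auto simp: B_carrier)
    show "a \<odot>\<^bsub>L\<^esub> (x \<oplus>\<^bsub>L\<^esub> y) = a \<odot>\<^bsub>L\<^esub> x \<oplus>\<^bsub>L\<^esub> a \<odot>\<^bsub>L\<^esub> y"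
      unfolding a using f x y
      by (intro L_eqI)
        (auto simp: L_smult_closed L_add_closed enc_L_smult enc_L_add distrib_left sum.distrib)
  next
    fix x assume x: "x \<in> carrier L"
    show "\<one>\<^bsub>B\<^esub> \<odot>\<^bsub>L\<^esub> x = x"
    proof (rule L_eqI)
      fix j assume j: "j \<in> {1..n}"
      have "(\<Sum>i\<in>{1..n}. symbol \<one>\<^bsub>A\<^esub> j i * enc_s (x i)) = (\<Sum>i\<in>{1..n}. if j = i then enc_s (x i) else 0)"
        by (intro sum.cong) (auto simp: symbol_one)
      then show "enc_s ((\<one>\<^bsub>B\<^esub> \<odot>\<^bsub>L\<^esub> x) j) = enc_s (x j)"
        using x j by (simp add: coset_one enc_L_smult)
    qed (use x in \<open>auto simp: coset_one L_smult_closed\<close>)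
  next
    fix a b x assume "a \<in> carrier B" and "b \<in> carrier B" and x: "x \<in> carrier L"
    then obtain f g where f: "f \<in> carrier A" and a: "a = coset f"
      and g: "g \<in> carrier A" and b: "b = coset g"
      by (auto simp: B_carrier)
    show "(a \<oplus>\<^bsub>B\<^esub> b) \<odot>\<^bsub>L\<^esub> x = a \<odot>\<^bsub>L\<^esub> x \<oplus>\<^bsub>L\<^esub> b \<odot>\<^bsub>L\<^esub> x"
      unfolding a b coset_add[OF f g] using f g x
      by (intro L_eqI)
        (auto simp: L_smult_closed L_add_closed enc_L_smult enc_L_add symbol_add distrib_right sum.distrib)
    show "(a \<otimes>\<^bsub>B\<^esub> b) \<odot>\<^bsub>L\<^esub> x = a \<odot>\<^bsub>L\<^esub> (b \<odot>\<^bsub>L\<^esub> x)"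
    proof (rule L_eqI)
      fix j assume j: "j \<in> {1..n}"
      have "enc_s (((a \<otimes>\<^bsub>B\<^esub> b) \<odot>\<^bsub>L\<^esub> x) j) =
          (\<Sum>i\<in>{1..n}. \<Sum>l\<in>{1..n}. symbol f j l * (symbol g l i * enc_s (x i)))"
        using f g x j
        by (simp add: a b coset_mult enc_L_smult symbol_mult sum_distrib_right mult.assoc)
      also have "\<dots> = (\<Sum>l\<in>{1..n}. \<Sum>i\<in>{1..n}. symbol f j l * (symbol g l i * enc_s (x i)))"
        by (rule sum.swap)
      also have "\<dots> = (\<Sum>l\<in>{1..n}. symbol f j l * enc_s ((b \<odot>\<^bsub>L\<^esub> x) l))"
        by (intro sum.cong refl) (simp add: b enc_L_smult[OF g x] sum_distrib_left)
      also have "\<dots> = enc_s ((a \<odot>\<^bsub>L\<^esub> (b \<odot>\<^bsub>L\<^esub> x)) j)"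
        by (simp only: a b enc_L_smult[OF f L_smult_closed[OF g x] j])
      finally show "enc_s (((a \<otimes>\<^bsub>B\<^esub> b) \<odot>\<^bsub>L\<^esub> x) j) = enc_s ((a \<odot>\<^bsub>L\<^esub> (b \<odot>\<^bsub>L\<^esub> x)) j)" .
    qed (use f g x in \<open>auto simp: a b coset_mult L_smult_closed\<close>)
  qed
  then show ?thesis
    by (intro left_module.intro ring_B abelian_group_L)
qed

end

section \<open>The center and a basis\<close>

context k_subset_family
begin

definition xy_power :: "nat \<Rightarrow> nat \<Rightarrow> path" where
  "xy_power i m = (concat (replicate m [X i, Y i]), i)"

text \<open>The series \<open>P(t)\<close>, where \<open>t\<^sup>m\<close> is represented by the sum of the loops
  \<open>(x\<^sub>i y\<^sub>i)\<^sup>m\<close> over all vertices.\<close>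

definition central :: "complex fps \<Rightarrow> path \<Rightarrow> complex" where
  "central P p = (if snd p \<in> {1..n} \<and> (\<exists>m. p = xy_power (snd p) m)
     then fps_nth P (length (fst p) div 2) else 0)"

lemma xy_power_path:
  assumes i: "i \<in> {1..n}"
  shows "is_path n (xy_power i m) \<and> path_target n (xy_power i m) = i \<and>
    path_wt (xy_power i m) = m * s \<and> length (fst (xy_power i m)) = 2 * m"
proof (induction m)
  case 0
  then show ?case using i by (simp add: xy_power_def path_wt_def)
next
  case (Suc m)
  then show ?case
    using i r_num_le[of i] by (auto simp: xy_power_def path_wt_def arrows_def)
qed

lemma central_xy_power: "i \<in> {1..n} \<Longrightarrow> central P (xy_power i m) = fps_nth P m"
  using xy_power_path[of i m] by (auto simp: central_def) (auto simp: xy_power_def)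

lemma central_carrier: "central P \<in> carrier A"
proof -
  have "central P p = 0" if "\<not> is_path n p" for p
    using that xy_power_path[of "snd p"] unfolding central_def by metis
  then show ?thesis by (simp add: carrier_cpa)
qed

text \<open>The loop \<open>x_i y_i\<close> has weight \<open>(s - r_i) + r_i = s\<close> at every
  vertex, so the symbol is the scalar matrix with entry \<open>P(u^s)\<close>.\<close>

lemma symbol_central:
  assumes i: "i \<in> {1..n}"
  shows "symbol (central P) j i = (if j = i then stretch s P else 0)"
proof (rule fps_ext)
  fix d
  have nonzero: "j = i \<and> s dvd d \<and> p = xy_power i (d div s)"
    if p: "p \<in> paths j i d" and nz: "central P p \<noteq> 0" for p
  proof -
    obtain m where "p = xy_power i m"
      using nz p by (auto simp only: central_def paths_def mem_Collect_eq split: if_splits)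
    then show ?thesis
      using p xy_power_path[OF i, of m] s_pos by (auto simp: paths_def)
  qed
  show "fps_nth (symbol (central P) j i) d = fps_nth (if j = i then stretch s P else 0) d"
  proof (cases "j = i \<and> s dvd d")
    case True
    then have mem: "xy_power i (d div s) \<in> paths j i d"
      using xy_power_path[OF i, of "d div s"] by (auto simp: paths_def xy_power_def)
    have "(\<Sum>p\<in>paths j i d. central P p) = (\<Sum>p\<in>{xy_power i (d div s)}. central P p)"
      by (rule sum.mono_neutral_right) (use mem nonzero finite_paths_wt in auto)
    then show ?thesis
      using True i by (simp add: symbol_nth stretch_nth[OF s_pos] central_xy_power)
  next
    case False
    then have "(\<Sum>p\<in>paths j i d. central P p) = 0"
      using nonzero by (intro sum.neutral) blast
    then show ?thesis
      using False by (auto simp: symbol_nth stretch_nth[OF s_pos])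
  qed
qed

definition scal :: "complex fps \<Rightarrow> (path \<Rightarrow> complex) set" where
  "scal P = coset (central P)"

lemma scal_inject: "scal P = scal Q \<Longrightarrow> P = Q"
proof -
  have "1 \<in> {1..n}" using n_pos by simp
  moreover assume "scal P = scal Q"
  ultimately have "symbol (central P) 1 1 = symbol (central Q) 1 1"
    by (simp only: scal_def coset_eq_iff[OF central_carrier central_carrier])
  then show ?thesis
    using stretch_inject[OF s_pos] n_pos by (simp add: symbol_central)
qed

lemma scal_zero: "scal 0 = \<zero>\<^bsub>B\<^esub>"
proof -
  interpret A: ring A by (rule ring_A)
  have "stretch s 0 = 0" by (rule fps_ext) (simp add: stretch_nth[OF s_pos])
  then show ?thesis
    unfolding scal_def coset_zero
    by (simp add: coset_eq_iff[OF central_carrier A.zero_closed] symbol_central symbol_zero)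
qed

lemma scal_smult:
  assumes v: "v \<in> carrier L" and j: "j \<in> {1..n}"
  shows "(scal P \<odot>\<^bsub>L\<^esub> v) j = P \<cdot>\<^sub>v v j"
proof (rule enc_inject[OF s_pos])
  show "(scal P \<odot>\<^bsub>L\<^esub> v) j \<in> carrier_vec s"
    unfolding scal_def by (rule L_index[OF L_smult_closed[OF central_carrier v] j])
  show "P \<cdot>\<^sub>v v j \<in> carrier_vec s" using L_index[OF v j] by simp
  have "enc_s ((scal P \<odot>\<^bsub>L\<^esub> v) j) = (\<Sum>i\<in>{1..n}. symbol (central P) j i * enc_s (v i))"
    unfolding scal_def by (rule enc_L_smult[OF central_carrier v j])
  also have "\<dots> = (\<Sum>i\<in>{1..n}. if j = i then stretch s P * enc_s (v i) else 0)"
    by (intro sum.cong) (auto simp: symbol_central)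
  also have "\<dots> = enc_s (P \<cdot>\<^sub>v v j)"
    using j by (simp add: enc_smult[OF s_pos L_index[OF v j]])
  finally show "enc_s ((scal P \<odot>\<^bsub>L\<^esub> v) j) = enc_s (P \<cdot>\<^sub>v v j)" .
qed

lemma scal_central: "scal P \<in> carrier (ring_center B)"
proof -
  interpret A: ring A by (rule ring_A)
  have "coset (central P) \<otimes>\<^bsub>B\<^esub> coset f = coset f \<otimes>\<^bsub>B\<^esub> coset (central P)" if f: "f \<in> carrier A" for f
  proof -
    have "symbol (central P \<otimes>\<^bsub>A\<^esub> f) j i = symbol (f \<otimes>\<^bsub>A\<^esub> central P) j i"
      if j: "j \<in> {1..n}" and i: "i \<in> {1..n}" for i j
    proof -
      have "symbol (central P \<otimes>\<^bsub>A\<^esub> f) j i = (\<Sum>l\<in>{1..n}. if j = l then stretch s P * symbol f l i else 0)"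
        unfolding symbol_mult by (intro sum.cong) (auto simp: symbol_central)
      moreover have "symbol (f \<otimes>\<^bsub>A\<^esub> central P) j i = (\<Sum>l\<in>{1..n}. if i = l then symbol f j l * stretch s P else 0)"
        unfolding symbol_mult using i by (intro sum.cong) (auto simp: symbol_central)
      ultimately show ?thesis using i j by (simp add: mult.commute)
    qed
    then show ?thesis
      using f central_carrier by (simp add: coset_mult coset_eq_iff)
  qed
  then show ?thesis
    unfolding ring_center_simps scal_def using central_carrier by (auto simp: B_carrier)
qed

text \<open>Since \<open>y\<close> has degree \<open>k\<close> and \<open>x\<close> has degree \<open>n - k\<close>, the degree of a path is congruent to
  \<open>- k\<close> times its shift modulo \<open>n\<close>. So loops have degrees divisible by \<open>n\<close>, and weights divisible
  by \<open>s\<close>.\<close>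

lemma loop_wt_dvd:
  assumes p: "is_path n p" and loop: "path_target n p = snd p"
  shows "s dvd path_wt p"
proof -
  define i where "i = snd p"
  have i: "i \<in> {1..n}" using p is_path_source[of n "fst p" i] by (simp add: i_def)
  obtain bs where bs: "p = (word bs i, i)"
    using ex_word[of "fst p" i] p by (metis i_def prod.collapse)
  have "vtx n (int i + shift bs) = vtx n (int i)"
    using loop path_word[OF i, of bs] i by (simp add: bs vtx_of_nat)
  then have "int n dvd shift bs"
    by (simp add: vtx_eq_iff[OF n_pos] mod_eq_dvd_iff)
  \<comment> \<open>Each \<open>x\<close> contributes \<open>(n - k) + k = n\<close> and each
    \<open>y\<close> contributes \<open>k - k = 0\<close>.\<close>
  moreover have "int (\<Sum>b\<leftarrow>cs. if b then n - k else k) + int k * shift cs =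
      int n * (\<Sum>b\<leftarrow>cs. if b then 1 else 0)" for cs
    by (induction cs) (use k_less in \<open>auto simp: of_nat_diff algebra_simps\<close>)
  then have "int (path_deg p) = int n * (\<Sum>b\<leftarrow>bs. if b then 1 else 0) - int k * shift bs"
    unfolding bs path_deg_word by (metis add_diff_cancel_right')
  ultimately have "int n dvd int (path_deg p)" by simp
  then obtain c where c: "int (path_deg p) = int n * c" by blast
  have "int n * int (path_wt p) = int n * (int s * c)"
    using wt_deg[OF p] loop c by simp
  then have "int (path_wt p) = int s * c" using n_pos by simp
  then have "int s dvd int (path_wt p)" by simp
  then show ?thesis by simp
qed

lemma center_scal:
  assumes z: "z \<in> carrier (ring_center B)"
  shows "\<exists>P. z = scal P"
proof -
  interpret A: ring A by (rule ring_A)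
  obtain f where f: "f \<in> carrier A" and zf: "z = coset f"
    using z by (auto simp: B_carrier)
  have comm: "symbol (f \<otimes>\<^bsub>A\<^esub> g) j i = symbol (g \<otimes>\<^bsub>A\<^esub> f) j i"
    if g: "g \<in> carrier A" and "j \<in> {1..n}" "i \<in> {1..n}" for g i j
  proof -
    have "coset f \<otimes>\<^bsub>B\<^esub> coset g = coset g \<otimes>\<^bsub>B\<^esub> coset f"
      using z g unfolding zf ring_center_simps B_carrier by blast
    then have "coset (f \<otimes>\<^bsub>A\<^esub> g) = coset (g \<otimes>\<^bsub>A\<^esub> f)"
      by (simp only: coset_mult[OF f g] coset_mult[OF g f])
    then show ?thesis
      using that by (simp only: coset_eq_iff[OF A.m_closed[OF f g] A.m_closed[OF g f]])
  qed
  have single: "symbol f j (path_target n p) * fps_X ^ path_wt p =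
      (if j = path_target n p then fps_X ^ path_wt p * symbol f (snd p) (snd p) else 0)"
    if p: "is_path n p" and j: "j \<in> {1..n}" for p j
  proof -
    have tgt: "path_target n p \<in> {1..n}" and src: "snd p \<in> {1..n}"
      using is_path_target[OF p] is_path_source[of n "fst p" "snd p"] p by simp_all
    have "symbol (f \<otimes>\<^bsub>A\<^esub> single p) j (snd p) =
        (\<Sum>l\<in>{1..n}. if l = path_target n p then symbol f j l * fps_X ^ path_wt p else 0)"
      unfolding symbol_mult by (intro sum.cong) (auto simp: symbol_single[OF p])
    also have "\<dots> = symbol f j (path_target n p) * fps_X ^ path_wt p"
      using tgt by simp
    finally have 1: "symbol (f \<otimes>\<^bsub>A\<^esub> single p) j (snd p) = symbol f j (path_target n p) * fps_X ^ path_wt p" .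
    have "symbol (single p \<otimes>\<^bsub>A\<^esub> f) j (snd p) =
        (\<Sum>l\<in>{1..n}. if l = snd p then (if j = path_target n p then fps_X ^ path_wt p * symbol f l (snd p) else 0) else 0)"
      unfolding symbol_mult by (intro sum.cong) (auto simp: symbol_single[OF p])
    also have "\<dots> = (if j = path_target n p then fps_X ^ path_wt p * symbol f (snd p) (snd p) else 0)"
      using src by simp
    finally show ?thesis
      using 1 comm[OF single_carrier[OF p] j src] by simp
  qed
  \<comment> \<open>The trivial path at \<open>i\<close> has weight 0 and acts as the idempotent of
    that vertex.\<close>
  have off_diagonal: "symbol f j i = 0" if "j \<in> {1..n}" "i \<in> {1..n}" "j \<noteq> i" for i j
    using single[of "([], i)" j] that by (simp add: path_wt_def)
  \<comment> \<open>Commutation with \<open>X i\<close> gives this equality up to a power of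
    \<open>u\<close>, which cancels because \<open>\<complex>[[u]]\<close> is a domain.\<close>
  have step: "symbol f i i = symbol f (vtx n (int i - 1)) (vtx n (int i - 1))" if i: "i \<in> {1..n}" for i
  proof -
    have "is_path n ([X i], vtx n (int i - 1))"
      using i vtx_in[of "int i - 1"] by (simp add: arrows_def)
    from single[OF this i] show ?thesis
      by (simp add: mult.commute)
  qed
  define Q where "Q = symbol f 1 1"
  have diagonal: "symbol f i i = Q" if "i \<in> {1..n}" for i
    using that
  proof (induction i)
    case (Suc i)
    then show ?case
      using step[OF Suc.prems] by (cases "i = 0") (auto simp: vtx_of_nat Q_def)
  qed simp
  \<comment> \<open>No coefficients are lost: \<open>Q\<close> sums over loops at vertex 1, whose
    weights are multiples of \<open>s\<close> by \<open>loop_wt_dvd\<close>.\<close>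
  define P where "P = Abs_fps (\<lambda>m. fps_nth Q (m * s))"
  have "stretch s P = Q"
  proof (rule fps_ext)
    fix d
    have "fps_nth Q d = 0" if "\<not> s dvd d"
      unfolding Q_def symbol_nth
      by (rule sum.neutral) (use that loop_wt_dvd in \<open>auto simp: paths_def\<close>)
    then show "fps_nth (stretch s P) d = fps_nth Q d"
      by (auto simp: stretch_nth[OF s_pos] P_def)
  qed
  then have "z = scal P"
    unfolding zf scal_def coset_eq_iff[OF f central_carrier]
    using off_diagonal diagonal by (auto simp: symbol_central)
  then show ?thesis ..
qed

section \<open>The basis of unit vectors at the vertices\<close>

definition unit_at :: "nat \<Rightarrow> nat \<Rightarrow> nat \<Rightarrow> complex fps vec" where
  "unit_at i b = (\<lambda>j\<in>{1..n}. if j = i then unit_vec s b else 0\<^sub>v s)"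

definition units :: "(nat \<Rightarrow> complex fps vec) set" where
  "units = (\<lambda>(i, b). unit_at i b) ` ({1..n} \<times> {..<s})"

lemma unit_at_index:
  "j \<in> {1..n} \<Longrightarrow> c < s \<Longrightarrow> b < s \<Longrightarrow> unit_at i b j $ c = (if j = i \<and> c = b then 1 else 0)"
  by (auto simp: unit_at_def)

lemma unit_at_carrier: "unit_at i b \<in> carrier L"
  by (auto simp: unit_at_def L_carrier)

text \<open>A basis is a set of vectors, so the Kronecker delta is phrased by equality of vectors
  instead of equality of index pairs.\<close>

lemma units_index:
  assumes x: "x \<in> units" and i: "i \<in> {1..n}" and b: "b < s"
  shows "x i $ b = (if x = unit_at i b then 1 else 0)"
proof -
  obtain j c where x': "x = unit_at j c" "j \<in> {1..n}" "c < s" using x by (auto simp: units_def)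
  show ?thesis
  proof (cases "x = unit_at i b")
    case True
    then show ?thesis using i b by (simp add: unit_at_index)
  next
    case False
    then have "\<not> (i = j \<and> b = c)" using x' by auto
    then show ?thesis using False x' i b by (simp add: unit_at_index)
  qed
qed

lemma L_finsum_index:
  assumes "finite F" "g \<in> F \<rightarrow> carrier L" and j: "j \<in> {1..n}" and b: "b < s"
  shows "(\<Oplus>\<^bsub>L\<^esub>x\<in>F. g x) j $ b = (\<Sum>x\<in>F. g x j $ b)"
  using assms(1,2)
proof (induction F)
  case empty
  interpret L: abelian_group L by (rule abelian_group_L)
  show ?case using j b by (simp add: L_zero)
next
  case (insert x F)
  interpret L: abelian_group L by (rule abelian_group_L)
  have "(\<Oplus>\<^bsub>L\<^esub>x\<in>F. g x) \<in> carrier L" using insert.prems by (intro L.finsum_closed) auto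
  then have "dim_vec ((\<Oplus>\<^bsub>L\<^esub>x\<in>F. g x) j) = s" using L_index[OF _ j] by auto
  moreover have "(\<Oplus>\<^bsub>L\<^esub>x\<in>insert x F. g x) = g x \<oplus>\<^bsub>L\<^esub> (\<Oplus>\<^bsub>L\<^esub>x\<in>F. g x)"
    using insert by (intro L.finsum_insert) auto
  ultimately show ?case
    using insert j b by (simp add: L_add)
qed

text \<open>Turns existence as well as uniqueness of the coefficients into a comparison of
  entries.\<close>

lemma L_expansion_iff:
  assumes v: "v \<in> carrier L"
    and S: "\<And>x. x \<in> units \<Longrightarrow> c x = scal (P x)" and nS: "\<And>x. x \<notin> units \<Longrightarrow> c x = \<zero>\<^bsub>B\<^esub>"
  shows "v = (\<Oplus>\<^bsub>L\<^esub>x\<in>{x. c x \<noteq> \<zero>\<^bsub>B\<^esub>}. c x \<odot>\<^bsub>L\<^esub> x) \<longleftrightarrow>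
    (\<forall>i\<in>{1..n}. \<forall>b<s. v i $ b = P (unit_at i b))"
proof -
  interpret L: abelian_group L by (rule abelian_group_L)
  define F where "F = {x. c x \<noteq> \<zero>\<^bsub>B\<^esub>}"
  have F: "F \<subseteq> units" using nS by (auto simp: F_def)
  have fin: "finite F" using finite_subset[OF F] by (simp add: units_def)
  have carr: "x \<in> carrier L" if "x \<in> F" for x
    using that F unit_at_carrier by (auto simp: units_def)
  have smult_closed: "c x \<odot>\<^bsub>L\<^esub> x \<in> carrier L" if "x \<in> F" for x
    using that F S carr[OF that] L_smult_closed[OF central_carrier] by (auto simp: scal_def)
  have idx: "(\<Oplus>\<^bsub>L\<^esub>x\<in>F. c x \<odot>\<^bsub>L\<^esub> x) i $ b = P (unit_at i b)" if i: "i \<in> {1..n}" and b: "b < s" for i b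
  proof -
    have mem: "unit_at i b \<in> units" using i b by (auto simp: units_def)
    have "(\<Oplus>\<^bsub>L\<^esub>x\<in>F. c x \<odot>\<^bsub>L\<^esub> x) i $ b = (\<Sum>x\<in>F. (c x \<odot>\<^bsub>L\<^esub> x) i $ b)"
      using smult_closed by (intro L_finsum_index[OF fin _ i b]) auto
    also have "\<dots> = (\<Sum>x\<in>F. if x = unit_at i b then P x else 0)"
    proof (rule sum.cong[OF refl])
      fix x assume x: "x \<in> F"
      have "dim_vec (x i) = s" using L_index[OF carr[OF x] i] by auto
      then show "(c x \<odot>\<^bsub>L\<^esub> x) i $ b = (if x = unit_at i b then P x else 0)"
        using x F S scal_smult[OF carr[OF x] i] units_index[OF _ i b, of x] b by auto
    qed
    also have "\<dots> = (if unit_at i b \<in> F then P (unit_at i b) else 0)"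
      using fin by simp
    also have "\<dots> = P (unit_at i b)"
    \<comment> \<open>Outside the support the coefficient \<open>scal (P x)\<close> is zero, and
      injectivity of \<open>scal\<close> gives \<open>P x = 0\<close>, in agreement with the missing
      term.\<close>
    proof (cases "unit_at i b \<in> F")
      case False
      then have "scal (P (unit_at i b)) = scal 0"
        using S[OF mem] by (simp add: F_def scal_zero)
      then show ?thesis using scal_inject by fastforce
    qed simp
    finally show ?thesis .
  qed
  have sum_carr: "(\<Oplus>\<^bsub>L\<^esub>x\<in>F. c x \<odot>\<^bsub>L\<^esub> x) \<in> carrier L"
    using smult_closed by (intro L.finsum_closed) auto
  show ?thesis unfolding F_def[symmetric]
  proof
    assume "v = (\<Oplus>\<^bsub>L\<^esub>x\<in>F. c x \<odot>\<^bsub>L\<^esub> x)"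
    then show "\<forall>i\<in>{1..n}. \<forall>b<s. v i $ b = P (unit_at i b)" using idx by simp
  next
    assume eq: "\<forall>i\<in>{1..n}. \<forall>b<s. v i $ b = P (unit_at i b)"
    show "v = (\<Oplus>\<^bsub>L\<^esub>x\<in>F. c x \<odot>\<^bsub>L\<^esub> x)"
    proof (rule L_eqI[OF v sum_carr])
      fix i assume i: "i \<in> {1..n}"
      have "v i = (\<Oplus>\<^bsub>L\<^esub>x\<in>F. c x \<odot>\<^bsub>L\<^esub> x) i"
        using L_index[OF v i] L_index[OF sum_carr i] eq idx i by (intro eq_vecI) auto
      then show "enc_s (v i) = enc_s ((\<Oplus>\<^bsub>L\<^esub>x\<in>F. c x \<odot>\<^bsub>L\<^esub> x) i)" by simp
    qed
  qed
qed

lemma units_basis: "is_basis (ring_center B) L units"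
  unfolding is_basis_def ring_center_simps(4)
proof (intro conjI ballI)
  show "units \<subseteq> carrier L" using unit_at_carrier by (auto simp: units_def)
  have finite_support: "finite {x. c x \<noteq> \<zero>\<^bsub>B\<^esub>}" if "\<forall>x. x \<notin> units \<longrightarrow> c x = \<zero>\<^bsub>B\<^esub>" for c
    by (rule finite_subset[of _ units]) (use that in \<open>auto simp: units_def\<close>)
  fix v assume v: "v \<in> carrier L"
  \<comment> \<open>The pairing of \<open>v\<close> with \<open>x\<close> extracts the entry of
    \<open>v\<close> that belongs to a unit vector, without a choice of its index pair.\<close>
  define P where "P x = (\<Sum>i\<in>{1..n}. \<Sum>b<s. v i $ b * x i $ b)" for x
  have P: "P (unit_at i b) = v i $ b" if i: "i \<in> {1..n}" and b: "b < s" for i b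
  proof -
    have "P (unit_at i b) = (\<Sum>j\<in>{1..n}. \<Sum>c<s. if c = b then (if j = i then v j $ c else 0) else 0)"
      unfolding P_def using b by (intro sum.cong refl) (auto simp: unit_at_index)
    then show ?thesis using i b by simp
  qed
  define c where "c x = (if x \<in> units then scal (P x) else \<zero>\<^bsub>B\<^esub>)" for x
  show "\<exists>!c. (\<forall>x\<in>units. c x \<in> carrier (ring_center B)) \<and> (\<forall>x. x \<notin> units \<longrightarrow> c x = \<zero>\<^bsub>B\<^esub>) \<and>
      finite {x. c x \<noteq> \<zero>\<^bsub>B\<^esub>} \<and> v = (\<Oplus>\<^bsub>L\<^esub>x\<in>{x. c x \<noteq> \<zero>\<^bsub>B\<^esub>}. c x \<odot>\<^bsub>L\<^esub> x)"
  proof (rule ex1I[of _ c], intro conjI)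
    show "\<forall>x\<in>units. c x \<in> carrier (ring_center B)"
      unfolding c_def using scal_central by (simp del: ring_center_simps)
    show supp: "\<forall>x. x \<notin> units \<longrightarrow> c x = \<zero>\<^bsub>B\<^esub>" by (simp add: c_def)
    show "finite {x. c x \<noteq> \<zero>\<^bsub>B\<^esub>}" using supp by (rule finite_support)
    show "v = (\<Oplus>\<^bsub>L\<^esub>x\<in>{x. c x \<noteq> \<zero>\<^bsub>B\<^esub>}. c x \<odot>\<^bsub>L\<^esub> x)"
      using P by (subst L_expansion_iff[OF v, of c P]) (auto simp: c_def)
  next
    fix c' assume c': "(\<forall>x\<in>units. c' x \<in> carrier (ring_center B)) \<and> (\<forall>x. x \<notin> units \<longrightarrow> c' x = \<zero>\<^bsub>B\<^esub>) \<and>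
      finite {x. c' x \<noteq> \<zero>\<^bsub>B\<^esub>} \<and> v = (\<Oplus>\<^bsub>L\<^esub>x\<in>{x. c' x \<noteq> \<zero>\<^bsub>B\<^esub>}. c' x \<odot>\<^bsub>L\<^esub> x)"
    \<comment> \<open>Uniqueness needs the full center: arbitrary central coefficients are power
      series in \<open>t\<close>, and these are determined by the entries of
      \<open>v\<close>.\<close>
    then have "\<forall>x\<in>units. \<exists>Q. c' x = scal Q" using center_scal by blast
    then obtain Q where Q: "\<And>x. x \<in> units \<Longrightarrow> c' x = scal (Q x)" by metis
    have "\<forall>i\<in>{1..n}. \<forall>b<s. v i $ b = Q (unit_at i b)"
      using c' by (subst L_expansion_iff[OF v Q, symmetric]) auto
    then have "Q x = P x" if "x \<in> units" for x
      using that P by (auto simp: units_def)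
    then show "c' = c"
      using c' Q by (intro ext) (auto simp: c_def)
  qed
qed

lemma L_module_CM: "L \<in> CM B"
proof -
  have "finite units" by (simp add: units_def)
  then show ?thesis
    using left_module_L left_module_center_module[OF left_module_L] units_basis
      finitely_generated_of_center_basis[OF left_module_L _ units_basis]
    by (auto simp: CM_def free_module_def simp del: ring_center_simps)
qed

end

theorem proposition4p7:
  fixes k n s :: nat and I :: "nat \<Rightarrow> nat set"
  assumes "1 < k" and "2 * k \<le> n" and "s \<ge> 1"
    and "\<And>j. j \<in> {1..s} \<Longrightarrow> I j \<subseteq> {1..n} \<and> card (I j) = k"
  shows "L_module n s I \<in> CM (B_algebra k n)"
proof -
  interpret k_subset_family k n s I
    by unfold_locales (use assms in auto)
  show ?thesis by (rule L_module_CM)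
qed

end
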